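(* Let $T$ be a tree with $\kappa_{\mathrm m}(T)=2$. Then $M_T(x)=f(x)g(x)$, where $f,g\in\mathbb Z[x]$ are distinct monic polynomials irreducible over $\mathbb Q$, and $\operatorname{ord}_f\phi_T=\operatorname{ord}_g\phi_T=1$. If $H$ is generalized cospectral with $T$, then either $H$ is a tree, or $H=R\cup U$ (disjoint union), where $R$ is a tree and $U$ is a connected bipartite unicyclic graph. In the latter case, after interchanging $f$ and $g$ if necessary, $M_R(x)=f(x)$ and $M_U(x)=g(x)$.
   Context: All graphs are finite, simple and undirected. For a graph $G$, $A(G)$ is its adjacency matrix, $\phi_G(x)=\det(xI-A(G))$, and $\mathbf 1$ is the all-one vector. Two graphs are generalized cospectral if they have the same adjacency spectrum and their complements have the same adjacency spectrum. An adjacency eigenvalue is main if its eigenspace is not orthogonal to $\mathbf 1$; the main polynomial $M_G(x)$ is the product of $(x-\lambda)$ over the distinct main eigenvalues $\lambda$ of $G$ (it divides $\phi_G$ in $\mathbb Z[x]$). If $\phi_G=\prod_{i=1}^r f_i^{m_i}$ with $f_i$ distinct, monic and irreducible over $\mathbb Q$, the main-factor multiplicity is $\kappa_{\mathrm m}(G):=\sum_{i:\,f_i\mid M_G} m_i$. $\operatorname{ord}_f\phi$ denotes the multiplicity of the irreducible polynomial $f$ in $\phi$ over $\mathbb Q$. A connected graph is unicyclic if it contains exactly one cycle (equivalently, it has as many edges as vertices). *)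

theory Defs
  imports
    "Graph_Theory.Digraph_Component"
    "Graph_Theory.Pair_Digraph"
    "Jordan_Normal_Form.Char_Poly"
    "HOL-Computational_Algebra.Polynomial_Factorial"
    "HOL-Computational_Algebra.Field_as_Ring"
begin

text \<open>
  A finite simple undirected graph is a \<open>pair_graph\<close>: a finite vertex set with a symmetric,
  irreflexive set of arcs, each undirected edge being a pair of opposite arcs.
\<close>

text \<open>
  The library's \<open>cycle\<close> (and hence its \<open>forest\<close> and \<open>tree\<close>) refers to directed cycles, and
  traversing one edge back and forth counts. Undirected cycles are the ones of length at least 3.
  A cycle is identified with its set of undirected edges, so that neither its starting vertex nor
  its orientation matters.
\<close>

definition ugraph_cycles :: "'a pair_pre_digraph \<Rightarrow> 'a set set set" where
  "ugraph_cycles G = {(\<lambda>(u, v). {u, v}) ` set p | p.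
     pre_digraph.cycle (with_proj G) p \<and> 3 \<le> length p}"

definition tree_graph :: "'a pair_pre_digraph \<Rightarrow> bool" where
  "tree_graph G \<longleftrightarrow>
     pair_graph G \<and> Digraph_Component.connected (with_proj G) \<and> ugraph_cycles G = {}"

definition unicyclic_graph :: "'a pair_pre_digraph \<Rightarrow> bool" where
  "unicyclic_graph G \<longleftrightarrow>
     pair_graph G \<and> Digraph_Component.connected (with_proj G) \<and> (\<exists>!C. C \<in> ugraph_cycles G)"

definition bipartite_graph :: "'a pair_pre_digraph \<Rightarrow> bool" where
  "bipartite_graph G \<longleftrightarrow>
     pair_graph G \<and>
     (\<exists>X Y. pverts G = X \<union> Y \<and> X \<inter> Y = {} \<and> parcs G \<subseteq> X \<times> Y \<union> Y \<times> X)"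

definition complement_graph :: "'a pair_pre_digraph \<Rightarrow> 'a pair_pre_digraph" where
  "complement_graph G = \<lparr>pverts = pverts G,
     parcs = {(u, v). u \<in> pverts G \<and> v \<in> pverts G \<and> u \<noteq> v \<and> (u, v) \<notin> parcs G}\<rparr>"

definition is_disjoint_union ::
    "'a pair_pre_digraph \<Rightarrow> 'a pair_pre_digraph \<Rightarrow> 'a pair_pre_digraph \<Rightarrow> bool" where
  "is_disjoint_union H R U \<longleftrightarrow>
     pverts R \<inter> pverts U = {} \<and>
     H = \<lparr>pverts = pverts R \<union> pverts U, parcs = parcs R \<union> parcs U\<rparr>"

text \<open>
  Matrices are indexed by natural numbers, so an enumeration of the vertices is chosen. A different
  choice conjugates the adjacency matrix by a permutation matrix, which fixes the all-one vector;
  hence nothing below depends on it.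
\<close>

definition vertex_list :: "'a pair_pre_digraph \<Rightarrow> 'a list" where
  "vertex_list G = (SOME vs. distinct vs \<and> set vs = pverts G)"

definition adj_matrix :: "'a pair_pre_digraph \<Rightarrow> 'r :: comm_ring_1 mat" where
  "adj_matrix G = mat (card (pverts G)) (card (pverts G))
     (\<lambda>(i, j). if (vertex_list G ! i, vertex_list G ! j) \<in> parcs G then 1 else 0)"

definition all_ones :: "nat \<Rightarrow> real vec" where
  "all_ones n = vec n (\<lambda>_. 1)"

text \<open>
  The spectrum with multiplicities; no eigenvalue is lost over the reals, since the adjacency
  matrix is real symmetric.
\<close>

definition adj_spectrum :: "'a pair_pre_digraph \<Rightarrow> real multiset" where
  "adj_spectrum G = proots (char_poly (adj_matrix G))"

definition generalized_cospectral :: "'a pair_pre_digraph \<Rightarrow> 'b pair_pre_digraph \<Rightarrow> bool" where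
  "generalized_cospectral G H \<longleftrightarrow>
     adj_spectrum G = adj_spectrum H \<and>
     adj_spectrum (complement_graph G) = adj_spectrum (complement_graph H)"

definition main_eigenvalue :: "'a pair_pre_digraph \<Rightarrow> real \<Rightarrow> bool" where
  "main_eigenvalue G l \<longleftrightarrow>
     (\<exists>v. eigenvector (adj_matrix G) v l \<and> v \<bullet> all_ones (card (pverts G)) \<noteq> 0)"

definition main_poly :: "'a pair_pre_digraph \<Rightarrow> real poly" where
  "main_poly G = (\<Prod>l | main_eigenvalue G l. [:- l, 1:])"

abbreviation graph_poly :: "'a pair_pre_digraph \<Rightarrow> rat poly" where
  "graph_poly G \<equiv> char_poly (adj_matrix G)"

text \<open>
  The main polynomial has real coefficients by definition. It is in fact integral, so testing
  divisibility by a rational polynomial over the reals is the same as over the rationals.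
\<close>

definition main_factor_mult :: "'a pair_pre_digraph \<Rightarrow> nat" where
  "main_factor_mult G =
     (\<Sum>f | monic f \<and> irreducible f \<and> f dvd graph_poly G \<and> map_poly real_of_rat f dvd main_poly G.
        multiplicity f (graph_poly G))"

end

theory Submission
  imports Defs "Berlekamp_Zassenhaus.Factor_Bound"
begin

text \<open>
  In an orthonormal eigenbasis of the adjacency matrix \<open>A\<close>, the polynomial \<open>det (x I - A + J)\<close>, which
  is determined by the spectrum of the complement, equals \<open>\<phi> (1 + \<Sum> s\<^sub>i\<^sup>2 / (x - \<lambda>\<^sub>i))\<close>, where the
  \<open>s\<^sub>i\<close> are the coordinates of the all-one vector. Hence the main eigenvalues are the roots of the
  quotient of \<open>\<phi>\<close> by its gcd with this polynomial; the main polynomial is therefore rational and an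
  invariant of generalized cospectrality. For the tree \<open>T\<close>, the largest eigenvalue is main and simple,
  which excludes a single irreducible factor of multiplicity two, so the main polynomial is a product
  \<open>f g\<close> whose roots are simple eigenvalues.

  Now let \<open>H\<close> be generalized cospectral with \<open>T\<close>. Each component of \<open>H\<close> has a main eigenvalue, hence
  has all roots of \<open>f\<close> or all roots of \<open>g\<close> as main eigenvalues; two components cannot share one, as
  it would be a multiple eigenvalue of \<open>H\<close>. So there are at most two components. The traces of \<open>A\<^sup>2\<close>
  and of the odd powers of \<open>A\<close> show that \<open>H\<close> has one edge less than vertices and no odd closed walk.
\<close>

text \<open>The coefficients \<open>s\<^sub>i\<^sup>2\<close> are squares of real numbers, so the
  contributions of different eigenvectors to one eigenvalue cannot cancel. A main eigenvalue
  therefore loses exactly one from its multiplicity in passing from \<open>\<phi>\<close> to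
  \<open>det (x I - A + J)\<close>, and any other eigenvalue loses nothing; this is why the quotient
  by the gcd is squarefree. The gcd is formed over the rationals although the eigenvalues are only
  real. This gives rationality for every graph; applied to a single component of \<open>H\<close>,
  it explains why one root of \<open>f\<close> or \<open>g\<close> as a main eigenvalue forces all
  the others. The edge count leaves two components little freedom: a connected graph on
  \<open>k\<close> vertices has at least \<open>k - 1\<close> edges, and at least \<open>k\<close>
  if it contains a cycle. So one component is a tree and the other has as many edges as
  vertices.\<close>

hide_const (open) Coset.order module.smult

section \<open>Spectral decomposition of real symmetric matrices\<close>

text \<open>Sylvester's determinant identity: \<open>K * L\<close> and \<open>L * K\<close> are both
  block triangular with an identity block, and their determinants agree. With \<open>m = 1\<close>
  it reduces the determinant of a rank-one perturbation of the identity to a scalar.\<close>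

lemma det_one_plus_mult_commute:
  fixes U V :: "'a :: idom mat"
  assumes U: "U \<in> carrier_mat n m" and V: "V \<in> carrier_mat m n"
  shows "det (1\<^sub>m n + U * V) = det (1\<^sub>m m + V * U)"
proof -
  define K where "K = four_block_mat (1\<^sub>m n) (- U) V (1\<^sub>m m)"
  define L where "L = four_block_mat (1\<^sub>m n) U (0\<^sub>m m n) (1\<^sub>m m)"
  have K: "K \<in> carrier_mat (n + m) (n + m)" and L: "L \<in> carrier_mat (n + m) (n + m)"
    using U V by (auto simp: K_def L_def)
  have UV: "U * V \<in> carrier_mat n n" "V * U \<in> carrier_mat m m" using U V by auto
  have "K * L = four_block_mat (1\<^sub>m n) (0\<^sub>m n m) V (1\<^sub>m m + V * U)"
    unfolding K_def L_def
    by (subst mult_four_block_mat[of _ n n _ m _ m], (use U V UV in auto)[8],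
        rule arg_cong4[of _ _ _ _ _ _ _ _ four_block_mat], use U V UV in auto)
  then have "det (K * L) = det (1\<^sub>m m + V * U)"
    using V UV by (simp add: det_four_block_mat_upper_right_zero[of _ n _ m])
  moreover have "L * K = four_block_mat (1\<^sub>m n + U * V) (0\<^sub>m n m) V (1\<^sub>m m)"
    unfolding K_def L_def
    by (subst mult_four_block_mat[of _ n n _ m _ m], (use U V UV in auto)[8],
        rule arg_cong4[of _ _ _ _ _ _ _ _ four_block_mat], use U V UV in auto)
  then have "det (L * K) = det (1\<^sub>m n + U * V)"
    using U V UV by (simp add: det_four_block_mat_upper_right_zero[of _ n _ m])
  moreover have "det (K * L) = det (L * K)"
    by (simp only: det_mult[OF K L] det_mult[OF L K] mult.commute)
  ultimately show ?thesis by simp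
qed

text \<open>The hermitian form \<open>S\<close> of an eigenvector is \<open>k\<close> times its
  squared norm \<open>N\<close>, and symmetry of \<open>A\<close> makes it equal to its own
  conjugate.\<close>

lemma eigenvalue_real_symmetric:
  fixes A :: "real mat"
  assumes A: "A \<in> carrier_mat n n" and sym: "transpose_mat A = A"
    and ev: "eigenvalue (map_mat complex_of_real A) k"
  shows "k \<in> \<real>"
proof -
  from ev obtain v where v: "v \<in> carrier_vec n" "v \<noteq> 0\<^sub>v n"
    and Av: "map_mat complex_of_real A *\<^sub>v v = k \<cdot>\<^sub>v v"
    using A by (auto simp: eigenvalue_def eigenvector_def)
  have A_sym: "A $$ (i, j) = A $$ (j, i)" if "i < n" "j < n" for i j
    using that A arg_cong[OF sym, of "\<lambda>B. B $$ (i, j)"] by auto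
  have row: "(\<Sum>j<n. of_real (A $$ (i, j)) * v $ j) = k * v $ i" if "i < n" for i
    using arg_cong[OF Av, of "\<lambda>w. w $ i"] that A v
    by (simp add: scalar_prod_def lessThan_atLeast0)
  define S where "S = (\<Sum>i<n. \<Sum>j<n. cnj (v $ i) * of_real (A $$ (i, j)) * v $ j)"
  define N where "N = (\<Sum>i<n. (cmod (v $ i))\<^sup>2)"
  have "S = (\<Sum>i<n. cnj (v $ i) * (\<Sum>j<n. of_real (A $$ (i, j)) * v $ j))"
    by (simp add: S_def sum_distrib_left mult.assoc)
  also have "\<dots> = (\<Sum>i<n. k * (v $ i * cnj (v $ i)))"
    by (intro sum.cong) (auto simp: row)
  also have "\<dots> = k * of_real N"
    by (simp add: N_def sum_distrib_left complex_norm_square del: of_real_power)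
  finally have S1: "S = k * of_real N" .
  have "cnj S = (\<Sum>i<n. \<Sum>j<n. v $ i * of_real (A $$ (i, j)) * cnj (v $ j))"
    by (simp add: S_def)
  also have "\<dots> = (\<Sum>j<n. \<Sum>i<n. v $ i * of_real (A $$ (i, j)) * cnj (v $ j))"
    by (rule sum.swap)
  also have "\<dots> = S"
    unfolding S_def by (intro sum.cong refl) (auto simp: A_sym)
  finally have "cnj S = S" .
  moreover have "N \<noteq> 0"
  proof
    assume "N = 0"
    then have "\<forall>i<n. v $ i = 0"
      by (simp add: N_def sum_nonneg_eq_0_iff)
    with v show False by (metis carrier_vecD eq_vecI index_zero_vec)
  qed
  ultimately have "cnj k = k" using S1 by simp
  then show ?thesis by (simp add: complex_is_Real_iff complex_eq_iff)
qed

lemma char_poly_real_symmetric_splits: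
  fixes A :: "real mat"
  assumes A: "A \<in> carrier_mat n n" and sym: "transpose_mat A = A"
  obtains es where "char_poly A = (\<Prod>e\<leftarrow>es. [:- e, 1:])" "length es = n"
proof -
  interpret R: map_poly_inj_idom_hom complex_of_real ..
  let ?C = "map_mat complex_of_real A"
  have C: "?C \<in> carrier_mat n n" using A by simp
  obtain as where as: "char_poly ?C = (\<Prod>a\<leftarrow>as. [:- a, 1:])" "length as = n"
    using char_poly_factorized[OF C] by auto
  have real: "a \<in> \<real>" if "a \<in> set as" for a
  proof (rule eigenvalue_real_symmetric[OF A sym])
    show "eigenvalue ?C a"
      using that unfolding eigenvalue_root_char_poly[OF C] as(1) poly_prod_list_zero_iff by force
  qed
  define es where "es = map Re as"
  have as_es: "as = map of_real es"
    unfolding es_def map_map using real by (auto simp: list_eq_iff_nth_eq of_real_Re)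
  have "map_poly complex_of_real (char_poly A) = map_poly complex_of_real (\<Prod>e\<leftarrow>es. [:- e, 1:])"
    unfolding of_real_hom.char_poly_hom[OF A, symmetric] as(1) as_es
    by (simp add: R.hom_prod_list o_def hom_distribs)
  then have "char_poly A = (\<Prod>e\<leftarrow>es. [:- e, 1:])"
    using R.injectivity by blast
  then show thesis
    by (rule that) (simp add: es_def as(2))
qed


text \<open>Let \<open>e\<close> be the first unit vector. For nonzero \<open>w = v - e\<close>, the
  matrix \<open>W\<close> is the reflection in the hyperplane orthogonal to \<open>w\<close>. It
  interchanges \<open>e\<close> and \<open>v\<close> because both have length one, and being an
  involution it is its own inverse.\<close>

lemma householder_reflection:
  fixes v :: "real vec"
  assumes v: "v \<in> carrier_vec n" and norm: "v \<bullet> v = 1" and n: "0 < n"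
  obtains W where "W \<in> carrier_mat n n" "transpose_mat W = W" "W * W = 1\<^sub>m n" "col W 0 = v"
proof -
  define w where "w i = v $ i - (if i = 0 then 1 else 0)" for i
  define s where "s = (\<Sum>i<n. w i * w i)"
  \<comment> \<open>If \<open>v\<close> is the first unit vector, then \<open>s = 0\<close>, hence \<open>c = 0\<close> and \<open>W\<close> is the identity.\<close>
  define c where "c = 2 / s"
  define W where "W = mat n n (\<lambda>(i, j). (if i = j then 1 else 0) - c * w i * w j)"
  have W: "W \<in> carrier_mat n n" by (simp add: W_def)
  have "(\<Sum>i<n. v $ i * v $ i) = 1"
    using norm v by (simp add: scalar_prod_def lessThan_atLeast0)
  \<comment> \<open>Expanding the squares gives \<open>1 - 2 * v $ 0 + 1\<close>, since
    \<open>v\<close> is a unit vector.\<close>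
  then have s: "s = - 2 * w 0"
    using n by (simp add: s_def w_def algebra_simps sum.distrib sum_subtractf sum.delta
        if_distrib[of "\<lambda>x. _ * x"] cong: if_cong)
  have c: "c * c * s = 2 * c"
    by (simp add: c_def)
  have "transpose_mat W = W"
    by (rule eq_matI) (auto simp: W_def)
  moreover have "W * W = 1\<^sub>m n"
  proof (rule eq_matI)
    fix i j assume "i < dim_row (1\<^sub>m n)" "j < dim_col (1\<^sub>m n)"
    then have ij: "i < n" "j < n" by auto
    have "(W * W) $$ (i, j) =
        (\<Sum>k<n. ((if i = k then 1 else 0) - c * w i * w k) * ((if k = j then 1 else 0) - c * w k * w j))"
      using ij by (simp add: W_def scalar_prod_def lessThan_atLeast0)
    also have "\<dots> = (\<Sum>k<n. (if k = i then if i = j then 1 else 0 else 0)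
        - (if k = i then c * w i * w j else 0) - (if k = j then c * w i * w j else 0)
        + c * c * w i * w j * (w k * w k))"
      by (intro sum.cong) (auto simp: algebra_simps)
    also have "\<dots> = (if i = j then 1 else 0) - 2 * c * w i * w j + c * c * w i * w j * s"
      using ij by (simp add: sum.distrib sum_subtractf s_def sum_distrib_left)
    also have "\<dots> = (if i = j then 1 else 0) + (c * c * s - 2 * c) * (w i * w j)"
      by (simp add: algebra_simps)
    also have "\<dots> = 1\<^sub>m n $$ (i, j)" using ij c by simp
    finally show "(W * W) $$ (i, j) = 1\<^sub>m n $$ (i, j)" .
  qed (use W in auto)
  moreover have "col W 0 = v"
  proof (rule eq_vecI)
    fix i assume "i < dim_vec v"
    then have i: "i < n" using v by simp
    have "s = 0 \<Longrightarrow> w i = 0"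
      using i by (auto simp: s_def sum_nonneg_eq_0_iff)
    then have "c * w 0 * w i = - w i"
      using s by (cases "s = 0") (auto simp: c_def)
    then show "col W 0 $ i = v $ i"
      using i n by (simp add: W_def algebra_simps) (simp add: w_def)
  qed (use v W in auto)
  ultimately show thesis using that W by blast
qed

text \<open>Deflation: a reflection moves an eigenvector to the first coordinate axis. The first
  column of the conjugated matrix is then a multiple of the first unit vector, by symmetry so is the
  first row, and the remaining block is symmetric of smaller size.\<close>

lemma real_symmetric_diagonalization:
  fixes A :: "real mat"
  assumes "A \<in> carrier_mat n n" and "transpose_mat A = A"
  shows "\<exists>Q D. Q \<in> carrier_mat n n \<and> D \<in> carrier_mat n n \<and> diagonal_mat D \<and>
    transpose_mat Q * Q = 1\<^sub>m n \<and> A * Q = Q * D"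
  using assms
proof (induction n arbitrary: A)
  case 0
  then show ?case
    by (intro exI[of _ A]) (auto simp: diagonal_mat_def)
next
  case (Suc m A)
  let ?n = "Suc m"
  note A = Suc.prems(1) and sym = Suc.prems(2)
  obtain es where es: "char_poly A = (\<Prod>e\<leftarrow>es. [:- e, 1:])" "length es = ?n"
    using char_poly_real_symmetric_splits[OF A sym] .
  then obtain lam where "poly (char_poly A) lam = 0"
    by (cases es) auto
  then have "eigenvalue A lam"
    using eigenvalue_root_char_poly[OF A] by simp
  then obtain u where u: "u \<in> carrier_vec ?n" "u \<noteq> 0\<^sub>v ?n" "A *\<^sub>v u = lam \<cdot>\<^sub>v u"
    using A by (auto simp: eigenvalue_def eigenvector_def)
  define v where "v = (1 / sqrt (u \<bullet> u)) \<cdot>\<^sub>v u"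
  have uu: "u \<bullet> u > 0"
    using conjugate_square_greater_0_vec[OF u(1)] u(2) by (simp add: conjugate_vec_def)
  have v: "v \<in> carrier_vec ?n" and Av: "A *\<^sub>v v = lam \<cdot>\<^sub>v v" and vv: "v \<bullet> v = 1"
    using u uu A
    by (auto simp: v_def mult_mat_vec smult_smult_assoc mult.commute)
  obtain W where W: "W \<in> carrier_mat ?n ?n" "transpose_mat W = W" "W * W = 1\<^sub>m ?n" "col W 0 = v"
    using householder_reflection[OF v vv] by blast
  \<comment> \<open>As \<open>W\<close> is its own inverse, this is \<open>A\<close> in the
    reflected basis.\<close>
  define B where "B = W * A * W"
  have B: "B \<in> carrier_mat ?n ?n" using A W by (simp add: B_def)
  have Bsym: "transpose_mat B = B"
    using A W(1) by (simp add: B_def transpose_mult[of _ ?n ?n _ ?n] W(2) sym)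
  have "col B 0 = (W * A) *\<^sub>v col W 0"
    unfolding B_def using A W(1) by (intro col_mult2[of _ ?n ?n _ ?n]) auto
  also have "\<dots> = W *\<^sub>v (A *\<^sub>v v)"
    using A W v by simp
  also have "\<dots> = lam \<cdot>\<^sub>v (W *\<^sub>v col W 0)"
    using v W by (simp add: Av mult_mat_vec)
  also have "W *\<^sub>v col W 0 = col (W * W) 0"
    using W(1) by (intro col_mult2[symmetric, of _ ?n ?n _ ?n]) auto
  finally have colB: "col B 0 = lam \<cdot>\<^sub>v col (1\<^sub>m ?n) 0" by (simp only: W(3))
  have B0: "B $$ (i, 0) = (if i = 0 then lam else 0)" if "i < ?n" for i
    using arg_cong[OF colB, of "\<lambda>x. x $ i"] that B by simp
  have B0': "B $$ (0, i) = (if i = 0 then lam else 0)" if "i < ?n" for i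
    using B0[OF that] arg_cong[OF Bsym, of "\<lambda>x. x $$ (0, i)"] that B by simp
  define A3 where "A3 = mat m m (\<lambda>(i, j). B $$ (Suc i, Suc j))"
  have A3: "A3 \<in> carrier_mat m m" by (simp add: A3_def)
  have A3sym: "transpose_mat A3 = A3"
  proof (rule eq_matI)
    fix i j assume "i < dim_row A3" "j < dim_col A3"
    then show "transpose_mat A3 $$ (i, j) = A3 $$ (i, j)"
      using arg_cong[OF Bsym, of "\<lambda>x. x $$ (Suc i, Suc j)"] B by (simp add: A3_def)
  qed (simp_all add: A3_def)
  define L where "L = mat 1 1 (\<lambda>_. lam)"
  have B_block: "B = four_block_mat L (0\<^sub>m 1 m) (0\<^sub>m m 1) A3"
    using B by (intro eq_matI) (auto simp: L_def A3_def B0 B0')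
  obtain Q3 D3 where Q3: "Q3 \<in> carrier_mat m m" and D3: "D3 \<in> carrier_mat m m" "diagonal_mat D3"
    and QQ3: "transpose_mat Q3 * Q3 = 1\<^sub>m m" and AQ3: "A3 * Q3 = Q3 * D3"
    using Suc.IH[OF A3 A3sym] by blast
  define F where "F = four_block_mat (1\<^sub>m 1) (0\<^sub>m 1 m) (0\<^sub>m m 1) Q3"
  define D where "D = four_block_mat L (0\<^sub>m 1 m) (0\<^sub>m m 1) D3"
  have L: "L \<in> carrier_mat 1 1" by (simp add: L_def)
  have F: "F \<in> carrier_mat ?n ?n" and D: "D \<in> carrier_mat ?n ?n"
    using four_block_carrier_mat[OF one_carrier_mat Q3, of 1] four_block_carrier_mat[OF L D3(1)]
    by (auto simp: F_def D_def)
  have "transpose_mat F = four_block_mat (1\<^sub>m 1) (0\<^sub>m 1 m) (0\<^sub>m m 1) (transpose_mat Q3)"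
    unfolding F_def using Q3 by (subst transpose_four_block_mat) auto
  then have "transpose_mat F * F = four_block_mat (1\<^sub>m 1) (0\<^sub>m 1 m) (0\<^sub>m m 1) (1\<^sub>m m)"
    using Q3 QQ3 by (simp add: F_def mult_four_block_mat[of _ 1 1 _ m _ m _ _ 1 _ m])
  then have FF: "transpose_mat F * F = 1\<^sub>m ?n"
    by (simp only:) (rule eq_matI, auto)
  have BF: "B * F = F * D"
    unfolding B_block F_def D_def using A3 Q3 D3 L AQ3
    by (simp add: mult_four_block_mat[of _ 1 1 _ m _ m _ _ 1 _ m])
  define Q where "Q = W * F"
  have Q: "Q \<in> carrier_mat ?n ?n" using W F by (simp add: Q_def)
  have Q_t: "transpose_mat Q = transpose_mat F * W"
    unfolding Q_def using transpose_mult[OF W(1) F] W(2) by simp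
  have F_t: "transpose_mat F \<in> carrier_mat ?n ?n" using F by simp
  have "transpose_mat Q * Q = transpose_mat F * (W * W) * F"
    unfolding Q_t unfolding Q_def using W(1) F F_t
    by (simp add: assoc_mult_mat[of _ ?n ?n _ ?n _ ?n])
  then have "transpose_mat Q * Q = 1\<^sub>m ?n"
    using FF F_t by (simp add: W(3))
  moreover have "A * Q = Q * D"
  proof -
    have "Q * D = W * (B * F)"
      unfolding Q_def BF using W(1) F D by (simp add: assoc_mult_mat[of _ ?n ?n _ ?n _ ?n])
    also have "\<dots> = (W * W) * (A * (W * F))"
      unfolding B_def using W(1) F A by (simp add: assoc_mult_mat[of _ ?n ?n _ ?n _ ?n])
    also have "\<dots> = A * Q"
      using A Q by (simp add: W(3) Q_def[symmetric])
    finally show ?thesis by simp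
  qed
  moreover have "diagonal_mat D"
    using D3 by (auto simp: diagonal_mat_def D_def L_def)
  ultimately show ?case using Q D by blast
qed

text \<open>The transpose of \<open>Q\<close> is its inverse on both sides: one side is the
  orthonormality of the columns, the other is the completeness relation behind all later expansions
  in eigenvectors.\<close>

lemma real_symmetric_eigenbasis:
  fixes A :: "real mat"
  assumes A: "A \<in> carrier_mat n n" and sym: "transpose_mat A = A"
  shows "\<exists>q lam. (\<forall>i<n. \<forall>j<n. (\<Sum>k<n. q i k * q j k) = (if i = j then 1 else 0)) \<and>
    (\<forall>k<n. \<forall>l<n. (\<Sum>i<n. q i k * q i l) = (if k = l then 1 else 0)) \<and>
    (\<forall>i<n. \<forall>k<n. (\<Sum>l<n. A $$ (k, l) * q i l) = lam i * q i k) \<and>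
    char_poly A = (\<Prod>i<n. [:- lam i, 1:])"
proof -
  obtain Q D where Q: "Q \<in> carrier_mat n n" and D: "D \<in> carrier_mat n n" "diagonal_mat D"
    and QQ: "transpose_mat Q * Q = 1\<^sub>m n" and AQ: "A * Q = Q * D"
    using real_symmetric_diagonalization[OF A sym] by blast
  have Qt: "transpose_mat Q \<in> carrier_mat n n" using Q by simp
  have QQ': "Q * transpose_mat Q = 1\<^sub>m n"
    using mat_mult_left_right_inverse[OF Qt Q QQ] .
  have "A = A * (Q * transpose_mat Q)" using A by (simp add: QQ')
  also have "\<dots> = Q * D * transpose_mat Q"
    unfolding AQ[symmetric] by (rule assoc_mult_mat[OF A Q Qt, symmetric])
  finally have "similar_mat_wit A D Q (transpose_mat Q)"
    using A Q Qt D QQ QQ' by (auto simp: similar_mat_wit_def)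
  then have "char_poly A = char_poly D"
    by (intro char_poly_similar) (auto simp: similar_mat_def)
  also have "\<dots> = (\<Prod>a\<leftarrow>diag_mat D. [:- a, 1:])"
    using D by (intro char_poly_upper_triangular) (auto simp: diagonal_mat_def)
  also have "\<dots> = (\<Prod>i<n. [:- D $$ (i, i), 1:])"
    using D prod.distinct_set_conv_list[of "[0..<n]" "\<lambda>i. [:- D $$ (i, i), 1:]"]
    by (simp add: diag_mat_def o_def lessThan_atLeast0)
  finally have cp: "char_poly A = (\<Prod>i<n. [:- D $$ (i, i), 1:])" .
  show ?thesis
  proof (intro exI[of _ "\<lambda>i k. Q $$ (k, i)"] exI[of _ "\<lambda>i. D $$ (i, i)"] conjI allI impI)
    fix i j assume "i < n" "j < n"
    then show "(\<Sum>k<n. Q $$ (k, i) * Q $$ (k, j)) = (if i = j then 1 else 0)"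
      using arg_cong[OF QQ, of "\<lambda>M. M $$ (i, j)"] Q
      by (simp add: scalar_prod_def lessThan_atLeast0)
  next
    fix k l assume "k < n" "l < n"
    then show "(\<Sum>i<n. Q $$ (k, i) * Q $$ (l, i)) = (if k = l then 1 else 0)"
      using arg_cong[OF QQ', of "\<lambda>M. M $$ (k, l)"] Q
      by (simp add: scalar_prod_def lessThan_atLeast0)
  next
    fix i k assume ik: "i < n" "k < n"
    have "(\<Sum>l<n. Q $$ (k, l) * D $$ (l, i)) = (\<Sum>l<n. if l = i then Q $$ (k, i) * D $$ (i, i) else 0)"
      using D ik by (intro sum.cong) (auto simp: diagonal_mat_def)
    then show "(\<Sum>l<n. A $$ (k, l) * Q $$ (l, i)) = D $$ (i, i) * Q $$ (k, i)"
      using arg_cong[OF AQ, of "\<lambda>M. M $$ (k, i)"] Q A D ik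
      by (simp add: scalar_prod_def lessThan_atLeast0 mult.commute)
  qed (rule cp)
qed

section \<open>Eigenbases of graphs\<close>

text \<open>Entries are indexed by vertices instead of positions, so that a graph and a part of it
  can be compared on their common vertices.\<close>

definition adj :: "'a pair_pre_digraph \<Rightarrow> 'a \<Rightarrow> 'a \<Rightarrow> real" where
  "adj G u v = (if (u, v) \<in> parcs G then 1 else 0)"

lemma pair_graph_finite: "pair_graph G \<Longrightarrow> finite (pverts G)"
  by (simp add: pair_graph_def pair_digraph_def pair_fin_digraph_def pair_fin_digraph_axioms_def)

lemma pair_graph_sym: "pair_graph G \<Longrightarrow> (u, v) \<in> parcs G \<Longrightarrow> (v, u) \<in> parcs G"
  by (meson pair_graph_def pair_pseudo_graph_def pair_sym_digraph.arcs_symmetric)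

lemma pair_graph_arcD:
  assumes "pair_graph G" "(u, v) \<in> parcs G"
  shows "u \<in> pverts G" "v \<in> pverts G" "u \<noteq> v"
proof -
  interpret pair_graph G by fact
  show "u \<in> pverts G" "v \<in> pverts G" "u \<noteq> v"
    using assms(2) by (auto dest: in_arcsD1 in_arcsD2 no_loops')
qed

lemma pair_graphI:
  assumes "finite (pverts G)" "\<And>u v. (u, v) \<in> parcs G \<Longrightarrow> u \<in> pverts G \<and> u \<noteq> v \<and> (v, u) \<in> parcs G"
  shows "pair_graph G"
proof -
  have "v \<in> pverts G" if "(u, v) \<in> parcs G" for u v
    using assms(2)[of v u] assms(2)[OF that] by blast
  moreover have "finite (parcs G)"
    by (rule finite_subset[of _ "pverts G \<times> pverts G"]) (use assms calculation in auto)
  ultimately show ?thesis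
    using assms by unfold_locales (auto simp: symmetric_def sym_def)
qed

lemma vertex_list:
  assumes "pair_graph G"
  shows "distinct (vertex_list G)" "set (vertex_list G) = pverts G"
    "length (vertex_list G) = card (pverts G)"
proof -
  have "\<exists>vs. distinct vs \<and> set vs = pverts G"
    using finite_distinct_list[OF pair_graph_finite[OF assms]] by blast
  then have *: "distinct (vertex_list G) \<and> set (vertex_list G) = pverts G"
    unfolding vertex_list_def by (rule someI_ex)
  then show "distinct (vertex_list G)" "set (vertex_list G) = pverts G"
    "length (vertex_list G) = card (pverts G)"
    by (auto simp flip: distinct_card)
qed

lemma bij_betw_vertex_list:
  "pair_graph G \<Longrightarrow> bij_betw ((!) (vertex_list G)) {..<card (pverts G)} (pverts G)"
  by (rule bij_betw_nth) (simp_all add: vertex_list)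

lemma vertex_list_nth_mem:
  "pair_graph G \<Longrightarrow> i < card (pverts G) \<Longrightarrow> vertex_list G ! i \<in> pverts G"
  using vertex_list[of G] nth_mem by metis

lemma vertex_list_nth_ex:
  assumes "pair_graph G" "u \<in> pverts G"
  obtains i where "i < card (pverts G)" "u = vertex_list G ! i"
  using assms(2) unfolding vertex_list(2)[OF assms(1), symmetric] in_set_conv_nth
    vertex_list(3)[OF assms(1)] by metis

lemma sum_vertex_list:
  "pair_graph G \<Longrightarrow> (\<Sum>i<card (pverts G). f (vertex_list G ! i)) = (\<Sum>v\<in>pverts G. f v)"
  by (rule sum.reindex_bij_betw[OF bij_betw_vertex_list])

lemma adj_matrix_carrier [simp]:
  "adj_matrix G \<in> carrier_mat (card (pverts G)) (card (pverts G))"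
  by (simp add: adj_matrix_def)

lemma adj_matrix_index:
  "i < card (pverts G) \<Longrightarrow> j < card (pverts G) \<Longrightarrow>
    adj_matrix G $$ (i, j) = adj G (vertex_list G ! i) (vertex_list G ! j)"
  by (simp add: adj_matrix_def adj_def)

lemma adj_sym: "pair_graph G \<Longrightarrow> adj G u v = adj G v u"
  using pair_graph_sym[of G] by (auto simp: adj_def)

lemma adj_matrix_sym:
  assumes "pair_graph G"
  shows "transpose_mat (adj_matrix G :: real mat) = adj_matrix G"
  using adj_sym[OF assms] by (intro eq_matI) (auto simp: adj_matrix_index adj_matrix_def adj_def)

lemma (in comm_ring_hom) map_adj_matrix: "map_mat hom (adj_matrix G) = adj_matrix G"
  by (intro eq_matI) (auto simp: adj_matrix_def)

lemma (in comm_ring_hom) map_graph_char_poly: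
  "map_poly hom (char_poly (adj_matrix G)) = char_poly (adj_matrix G)"
  by (metis char_poly_hom[OF adj_matrix_carrier] map_adj_matrix)

text \<open>Eigenvectors become functions on the vertices, which can later be extended by zero from
  a part of a graph to the whole graph.\<close>

lemma main_eigenvalue_iff:
  assumes G: "pair_graph G"
  shows "main_eigenvalue G l \<longleftrightarrow>
    (\<exists>x. (\<forall>u\<in>pverts G. (\<Sum>v\<in>pverts G. adj G u v * x v) = l * x u) \<and> (\<Sum>u\<in>pverts G. x u) \<noteq> 0)"
proof
  let ?n = "card (pverts G)" and ?vs = "vertex_list G"
  assume "main_eigenvalue G l"
  then obtain v where v: "v \<in> carrier_vec ?n" "adj_matrix G *\<^sub>v v = l \<cdot>\<^sub>v v"
    and ones: "v \<bullet> all_ones ?n \<noteq> 0"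
    by (auto simp: main_eigenvalue_def eigenvector_def adj_matrix_def)
  define x where "x w = v $ (inv_into {..<?n} ((!) ?vs) w)" for w
  have x: "x (?vs ! i) = v $ i" if "i < ?n" for i
    using inv_into_f_f[of "(!) ?vs" "{..<?n}" i] bij_betw_vertex_list[OF G] that
    by (simp add: x_def bij_betw_def)
  have "(\<Sum>w\<in>pverts G. adj G u w * x w) = l * x u" if "u \<in> pverts G" for u
  proof -
    obtain i where i: "i < ?n" "u = ?vs ! i"
      using vertex_list_nth_ex[OF G \<open>u \<in> pverts G\<close>] by metis
    have "(\<Sum>w\<in>pverts G. adj G u w * x w) = (\<Sum>j<?n. adj G u (?vs ! j) * v $ j)"
      unfolding sum_vertex_list[OF G, symmetric] by (intro sum.cong) (auto simp: x)
    also have "\<dots> = (adj_matrix G *\<^sub>v v) $ i"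
      using i v(1) by (simp add: scalar_prod_def lessThan_atLeast0 adj_matrix_def adj_def)
    finally show ?thesis using i v x by simp
  qed
  moreover have "(\<Sum>u\<in>pverts G. x u) = v \<bullet> all_ones ?n"
    unfolding sum_vertex_list[OF G, symmetric]
    using v(1) by (simp add: scalar_prod_def all_ones_def lessThan_atLeast0 x)
  ultimately show "\<exists>x. (\<forall>u\<in>pverts G. (\<Sum>v\<in>pverts G. adj G u v * x v) = l * x u) \<and>
      (\<Sum>u\<in>pverts G. x u) \<noteq> 0"
    using ones by (intro exI[of _ x]) auto
next
  let ?n = "card (pverts G)" and ?vs = "vertex_list G"
  assume "\<exists>x. (\<forall>u\<in>pverts G. (\<Sum>v\<in>pverts G. adj G u v * x v) = l * x u) \<and>
    (\<Sum>u\<in>pverts G. x u) \<noteq> 0"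
  then obtain x where x: "\<And>u. u \<in> pverts G \<Longrightarrow> (\<Sum>v\<in>pverts G. adj G u v * x v) = l * x u"
    and sum: "(\<Sum>u\<in>pverts G. x u) \<noteq> 0" by blast
  define v where "v = vec ?n (\<lambda>i. x (?vs ! i))"
  have "v \<bullet> all_ones ?n = (\<Sum>u\<in>pverts G. x u)"
    unfolding sum_vertex_list[OF G, symmetric]
    by (simp add: v_def scalar_prod_def all_ones_def lessThan_atLeast0)
  with sum have ones: "v \<bullet> all_ones ?n \<noteq> 0" by simp
  then have "v \<noteq> 0\<^sub>v ?n"
    by (auto simp: all_ones_def scalar_prod_def)
  moreover have "adj_matrix G *\<^sub>v v = l \<cdot>\<^sub>v v"
  proof (rule eq_vecI)
    fix i assume "i < dim_vec (l \<cdot>\<^sub>v v)"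
    then have i: "i < ?n" by (simp add: v_def)
    have "(adj_matrix G *\<^sub>v v) $ i = (\<Sum>j<?n. adj G (?vs ! i) (?vs ! j) * x (?vs ! j))"
      using i by (simp add: scalar_prod_def lessThan_atLeast0 adj_matrix_def adj_def v_def)
    also have "\<dots> = l * x (?vs ! i)"
      unfolding sum_vertex_list[OF G, where f = "\<lambda>w. adj G (?vs ! i) w * x w"]
      using x vertex_list_nth_mem[OF G i] .
    finally show "(adj_matrix G *\<^sub>v v) $ i = (l \<cdot>\<^sub>v v) $ i" using i by (simp add: v_def)
  qed (simp add: v_def adj_matrix_def)
  ultimately have "eigenvector (adj_matrix G) v l"
    by (simp add: eigenvector_def v_def adj_matrix_def)
  with ones show "main_eigenvalue G l" by (auto simp: main_eigenvalue_def)
qed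

locale graph_eigenbasis =
  fixes G :: "'a pair_pre_digraph" and q :: "nat \<Rightarrow> 'a \<Rightarrow> real" and lam :: "nat \<Rightarrow> real"
  assumes G: "pair_graph G"
    and orth: "\<And>i j. i < card (pverts G) \<Longrightarrow> j < card (pverts G) \<Longrightarrow>
      (\<Sum>v\<in>pverts G. q i v * q j v) = (if i = j then 1 else 0)"
    and complete: "\<And>u v. u \<in> pverts G \<Longrightarrow> v \<in> pverts G \<Longrightarrow>
      (\<Sum>i<card (pverts G). q i u * q i v) = (if u = v then 1 else 0)"
    and eigen: "\<And>i u. i < card (pverts G) \<Longrightarrow> u \<in> pverts G \<Longrightarrow>
      (\<Sum>v\<in>pverts G. adj G u v * q i v) = lam i * q i u"
    and char_poly: "char_poly (adj_matrix G) = (\<Prod>i<card (pverts G). [:- lam i, 1:])"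

lemma ex_graph_eigenbasis:
  assumes G: "pair_graph G"
  obtains q lam where "graph_eigenbasis G q lam"
proof -
  let ?n = "card (pverts G)" and ?vs = "vertex_list G"
  obtain p :: "nat \<Rightarrow> nat \<Rightarrow> real" and lam :: "nat \<Rightarrow> real" where
    orth: "\<forall>i<?n. \<forall>j<?n. (\<Sum>k<?n. p i k * p j k) = (if i = j then 1 else 0)" and
    complete: "\<forall>k<?n. \<forall>l<?n. (\<Sum>i<?n. p i k * p i l) = (if k = l then 1 else 0)" and
    eigen: "\<forall>i<?n. \<forall>k<?n. (\<Sum>l<?n. adj_matrix G $$ (k, l) * p i l) = lam i * p i k" and
    char_poly: "char_poly (adj_matrix G) = (\<Prod>i<?n. [:- lam i, 1:])"
    using real_symmetric_eigenbasis[OF adj_matrix_carrier adj_matrix_sym[OF G]] by blast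
  define q where "q i w = p i (inv_into {..<?n} ((!) ?vs) w)" for i w
  have q: "q i (?vs ! k) = p i k" if "k < ?n" for i k
    using inv_into_f_f[of "(!) ?vs" "{..<?n}" k] bij_betw_vertex_list[OF G] that
    by (simp add: q_def bij_betw_def)
  note ex = vertex_list_nth_ex[OF G]
  have inj: "?vs ! k = ?vs ! l \<longleftrightarrow> k = l" if "k < ?n" "l < ?n" for k l
    using that nth_eq_iff_index_eq[OF vertex_list(1)[OF G]] by (simp add: vertex_list(3)[OF G])
  have "graph_eigenbasis G q lam"
  proof (rule graph_eigenbasis.intro)
    fix i j assume ij: "i < ?n" "j < ?n"
    have "(\<Sum>v\<in>pverts G. q i v * q j v) = (\<Sum>k<?n. p i k * p j k)"
      unfolding sum_vertex_list[OF G, symmetric] by (intro sum.cong) (auto simp: q)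
    with orth ij show "(\<Sum>v\<in>pverts G. q i v * q j v) = (if i = j then 1 else 0)" by simp
  next
    fix u v assume uv: "u \<in> pverts G" "v \<in> pverts G"
    obtain k l where "k < ?n" "u = ?vs ! k" "l < ?n" "v = ?vs ! l"
      using ex[OF uv(1)] ex[OF uv(2)] by metis
    then show "(\<Sum>i<?n. q i u * q i v) = (if u = v then 1 else 0)"
      by (simp add: q complete inj)
  next
    fix i u assume i: "i < ?n" and u: "u \<in> pverts G"
    obtain k where k: "k < ?n" "u = ?vs ! k"
      using ex[OF u] by metis
    have "(\<Sum>v\<in>pverts G. adj G u v * q i v) = (\<Sum>l<?n. adj_matrix G $$ (k, l) * p i l)"
      unfolding sum_vertex_list[OF G, symmetric]
      using k by (intro sum.cong) (auto simp: q adj_matrix_index)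
    with eigen i k(1) show "(\<Sum>v\<in>pverts G. adj G u v * q i v) = lam i * q i u"
      using k by (simp add: q)
  qed (fact G char_poly)+
  with that show thesis .
qed

context graph_eigenbasis
begin

abbreviation "n \<equiv> card (pverts G)"

lemma fin: "finite (pverts G)" by (rule pair_graph_finite[OF G])

lemma expansion:
  assumes "u \<in> pverts G"
  shows "(\<Sum>i<n. (\<Sum>v\<in>pverts G. x v * q i v) * q i u) = x u"
proof -
  have "(\<Sum>i<n. (\<Sum>v\<in>pverts G. x v * q i v) * q i u) =
      (\<Sum>v\<in>pverts G. \<Sum>i<n. x v * (q i v * q i u))"
    by (subst sum.swap) (simp add: sum_distrib_right mult.assoc)
  also have "\<dots> = (\<Sum>v\<in>pverts G. x v * (if v = u then 1 else 0))"
    using assms by (intro sum.cong refl) (simp add: complete flip: sum_distrib_left)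
  also have "\<dots> = x u"
    using assms fin by (simp add: if_distrib[of "\<lambda>c. _ * c"] cong: if_cong)
  finally show ?thesis .
qed

lemma parseval:
  "(\<Sum>u\<in>pverts G. x u * y u) = (\<Sum>i<n. (\<Sum>v\<in>pverts G. x v * q i v) * (\<Sum>v\<in>pverts G. y v * q i v))"
proof -
  define c where "c i = (\<Sum>v\<in>pverts G. x v * q i v)" for i
  have "(\<Sum>u\<in>pverts G. x u * y u) = (\<Sum>u\<in>pverts G. (\<Sum>i<n. c i * q i u) * y u)"
    by (intro sum.cong refl) (simp add: expansion c_def)
  also have "\<dots> = (\<Sum>u\<in>pverts G. \<Sum>i<n. c i * (y u * q i u))"
    by (simp add: sum_distrib_left mult_ac)
  also have "\<dots> = (\<Sum>i<n. c i * (\<Sum>u\<in>pverts G. y u * q i u))"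
    by (subst sum.swap) (simp add: sum_distrib_left)
  finally show ?thesis by (simp add: c_def)
qed

text \<open>Symmetry of the adjacency matrix moves it from \<open>x\<close> to the eigenvector
  \<open>q i\<close>.\<close>

lemma coeff_adj:
  assumes "i < n"
  shows "(\<Sum>u\<in>pverts G. (\<Sum>v\<in>pverts G. adj G u v * x v) * q i u) =
    lam i * (\<Sum>v\<in>pverts G. x v * q i v)"
proof -
  have "(\<Sum>u\<in>pverts G. (\<Sum>v\<in>pverts G. adj G u v * x v) * q i u) =
      (\<Sum>v\<in>pverts G. \<Sum>u\<in>pverts G. x v * (adj G v u * q i u))"
    by (subst sum.swap) (simp add: sum_distrib_left adj_sym[OF G] mult_ac)
  also have "\<dots> = (\<Sum>v\<in>pverts G. x v * (lam i * q i v))"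
    using assms by (intro sum.cong refl) (simp add: eigen flip: sum_distrib_left)
  finally show ?thesis by (simp add: sum_distrib_left mult_ac)
qed

lemma coeff_eigenvector_eq_0:
  assumes "i < n" "lam i \<noteq> l"
    and x: "\<And>u. u \<in> pverts G \<Longrightarrow> (\<Sum>v\<in>pverts G. adj G u v * x v) = l * x u"
  shows "(\<Sum>v\<in>pverts G. x v * q i v) = 0"
proof -
  have "lam i * (\<Sum>v\<in>pverts G. x v * q i v) = l * (\<Sum>v\<in>pverts G. x v * q i v)"
    using coeff_adj[OF assms(1), of x] by (simp add: x sum_distrib_left mult.assoc)
  with assms(2) show ?thesis by simp
qed

text \<open>By \<open>parseval\<close> against the all-one vector, a nonzero sum of entries of
  \<open>x\<close> needs an index where both vectors have a nonzero coefficient, and an eigenvector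
  for \<open>l\<close> has coefficients only where \<open>lam i = l\<close>.\<close>

lemma main_eigenvalue_iff_coeff:
  "main_eigenvalue G l \<longleftrightarrow> (\<exists>i<n. lam i = l \<and> (\<Sum>v\<in>pverts G. q i v) \<noteq> 0)"
proof
  assume "main_eigenvalue G l"
  then obtain x where x: "\<And>u. u \<in> pverts G \<Longrightarrow> (\<Sum>v\<in>pverts G. adj G u v * x v) = l * x u"
    and sum: "(\<Sum>u\<in>pverts G. x u) \<noteq> 0"
    using main_eigenvalue_iff[OF G] by blast
  have "(\<Sum>i<n. (\<Sum>v\<in>pverts G. x v * q i v) * (\<Sum>v\<in>pverts G. q i v)) \<noteq> 0"
    using parseval[of x "\<lambda>_. 1"] sum by simp
  then obtain i where "i \<in> {..<n}"
    "(\<Sum>v\<in>pverts G. x v * q i v) * (\<Sum>v\<in>pverts G. q i v) \<noteq> 0"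
    by (rule sum.not_neutral_contains_not_neutral)
  with coeff_eigenvector_eq_0[OF _ _ x, of i] show "\<exists>i<n. lam i = l \<and> (\<Sum>v\<in>pverts G. q i v) \<noteq> 0"
    by auto
next
  assume "\<exists>i<n. lam i = l \<and> (\<Sum>v\<in>pverts G. q i v) \<noteq> 0"
  then obtain i where "i < n" "lam i = l" "(\<Sum>v\<in>pverts G. q i v) \<noteq> 0"
    by blast
  then show "main_eigenvalue G l"
    unfolding main_eigenvalue_iff[OF G] by (intro exI[of _ "q i"]) (auto simp: eigen)
qed

lemma proots_char_poly: "proots (char_poly (adj_matrix G)) = image_mset lam (mset_set {..<n})"
proof -
  have "proots (char_poly (adj_matrix G)) = (\<Sum>i<n. proots [:- lam i, 1:])"
    unfolding char_poly by (rule proots_prod) simp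
  also have "\<dots> = (\<Sum>i<n. {#lam i#})"
    by (simp only: proots_linear_factor minus_minus)
  finally show ?thesis by (simp add: sum_unfold_sum_mset)
qed

lemma order_char_poly: "order l (char_poly (adj_matrix G)) = card {i. i < n \<and> lam i = l}"
proof -
  have "char_poly (adj_matrix G) \<noteq> (0 :: real poly)"
    unfolding char_poly by simp
  then have "order l (char_poly (adj_matrix G)) = count (image_mset lam (mset_set {..<n})) l"
    using count_proots[of "char_poly (adj_matrix G)" l] by (simp add: proots_char_poly)
  also have "\<dots> = card {i. i < n \<and> lam i = l}"
    by (auto simp: count_image_mset vimage_def Int_def intro!: arg_cong[where f = card])
  finally show ?thesis .
qed

text \<open>A one-dimensional eigenspace contains no two orthogonal nonzero vectors.\<close>

lemma order_char_poly_ge_2: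
  assumes x: "\<And>u. u \<in> pverts G \<Longrightarrow> (\<Sum>v\<in>pverts G. adj G u v * x v) = l * x u"
    and y: "\<And>u. u \<in> pverts G \<Longrightarrow> (\<Sum>v\<in>pverts G. adj G u v * y v) = l * y u"
    and nz: "u \<in> pverts G" "x u \<noteq> 0" "w \<in> pverts G" "y w \<noteq> 0"
    and xy: "(\<Sum>v\<in>pverts G. x v * y v) = 0"
  shows "2 \<le> order l (char_poly (adj_matrix G))"
proof (rule ccontr)
  let ?I = "{i. i < n \<and> lam i = l}"
  let ?c = "\<lambda>z i. \<Sum>v\<in>pverts G. z v * q i v"
  have fI: "finite ?I" by simp
  have support: "i \<in> ?I" if "i < n" "?c z i \<noteq> 0"
    "\<And>u. u \<in> pverts G \<Longrightarrow> (\<Sum>v\<in>pverts G. adj G u v * z v) = l * z u" for z i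
    using coeff_eigenvector_eq_0[of i l z] that by auto
  have ex: "\<exists>i<n. ?c z i \<noteq> 0" if "v \<in> pverts G" "z v \<noteq> 0" for z v
  proof -
    have "(\<Sum>i<n. ?c z i * q i v) \<noteq> 0" using expansion[of v z] that by simp
    then obtain i where "i \<in> {..<n}" "?c z i * q i v \<noteq> 0"
      by (rule sum.not_neutral_contains_not_neutral)
    then show ?thesis by auto
  qed
  obtain i where i: "i < n" "?c x i \<noteq> 0" using ex nz by blast
  obtain j where j: "j < n" "?c y j \<noteq> 0" using ex nz by blast
  have iI: "i \<in> ?I" and jI: "j \<in> ?I"
    by (rule support[OF i x], assumption) (rule support[OF j y])
  assume "\<not> 2 \<le> order l (char_poly (adj_matrix G))"
  then have "card ?I \<le> Suc 0" by (simp add: order_char_poly)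
  then have only: "k = i" if "k \<in> ?I" for k
    using that iI card_le_Suc0_iff_eq[OF fI] by blast
  \<comment> \<open>By assumption only the index \<open>i\<close> belongs to \<open>l\<close>, so
    the inner product of \<open>x\<close> and \<open>y\<close> collapses to one product.\<close>
  have "?c x k * ?c y k = (if k = i then ?c x i * ?c y i else 0)" if "k < n" for k
  proof (cases "k = i")
    case False
    then have "k \<notin> ?I" using only by blast
    then have "?c x k = 0" using support[OF that _ x] by blast
    with False show ?thesis by simp
  qed simp
  then have "(\<Sum>k<n. ?c x k * ?c y k) = (\<Sum>k<n. if k = i then ?c x i * ?c y i else 0)"
    by (intro sum.cong refl) simp
  also have "\<dots> = ?c x i * ?c y i" using i by simp
  finally have "?c y i = 0" using xy parseval[of x y] i by simp
  moreover have "j = i" using only jI by blast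
  ultimately show False using j by simp
qed

end

section \<open>Main eigenvalues and the complement\<close>

lemma complement_graph_simps [simp]:
  "pverts (complement_graph G) = pverts G"
  "vertex_list (complement_graph G) = vertex_list G"
  "(u, v) \<in> parcs (complement_graph G) \<longleftrightarrow>
    u \<in> pverts G \<and> v \<in> pverts G \<and> u \<noteq> v \<and> (u, v) \<notin> parcs G"
  by (simp_all add: complement_graph_def vertex_list_def)

lemma pair_graph_complement: "pair_graph G \<Longrightarrow> pair_graph (complement_graph G)"
  by (rule pair_graphI) (auto simp: pair_graph_finite dest: pair_graph_sym)

text \<open>
  This is \<open>det (x I - A + J)\<close>, expressed through the complement, whose adjacency matrix is
  \<open>J - I - A\<close>.
\<close>

definition compl_poly :: "'a pair_pre_digraph \<Rightarrow> 'r :: comm_ring_1 poly" where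
  "compl_poly G = smult ((- 1) ^ card (pverts G))
     (char_poly (adj_matrix (complement_graph G)) \<circ>\<^sub>p [:- 1, - 1:])"

lemma (in comm_ring_hom) map_compl_poly: "map_poly hom (compl_poly G) = compl_poly G"
proof -
  interpret R: map_poly_comm_ring_hom hom ..
  show ?thesis
    by (simp add: compl_poly_def hom_distribs map_poly_pcompose map_graph_char_poly)
qed

context graph_eigenbasis
begin

abbreviation "s i \<equiv> \<Sum>v\<in>pverts G. q i v"

text \<open>This is the matrix determinant lemma. With \<open>B = y I - A\<close> and
  \<open>x\<close> the solution of \<open>B x = 1\<close>, the all-one matrix \<open>J\<close>
  equals \<open>B * U * R\<close>, so \<open>y I - A + J = B * (1 + U * R)\<close>. Here
  \<open>det B\<close> gives the product and the rank-one factor gives the bracket.\<close>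

lemma poly_compl_poly:
  assumes y: "\<And>i. i < n \<Longrightarrow> lam i \<noteq> y"
  shows "poly (compl_poly G) y = (\<Prod>i<n. y - lam i) * (1 + (\<Sum>i<n. (s i)\<^sup>2 / (y - lam i)))"
proof -
  let ?vs = "vertex_list G" and ?A = "adj_matrix G :: real mat"
    and ?C = "adj_matrix (complement_graph G) :: real mat"
  have C: "?C \<in> carrier_mat n n" using adj_matrix_carrier[of "complement_graph G"] by simp
  define B where "B = - char_matrix ?A y"
  \<comment> \<open>The solution of \<open>(y I - A) x = 1\<close> written in the eigenbasis; the
    denominators are nonzero because \<open>y\<close> is not an eigenvalue.\<close>
  define x where "x u = (\<Sum>i<n. s i / (y - lam i) * q i u)" for u
  define U where "U = mat n 1 (\<lambda>(k, _). x (?vs ! k))"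
  define R where "R = mat 1 n (\<lambda>_. 1 :: real)"
  have B: "B \<in> carrier_mat n n" and U: "U \<in> carrier_mat n 1" and R: "R \<in> carrier_mat 1 n"
    by (simp_all add: B_def U_def R_def)
  have B_index: "B $$ (i, j) = (if i = j then y else 0) - adj G (?vs ! i) (?vs ! j)"
    if "i < n" "j < n" for i j
    using that by (simp add: B_def char_matrix_def adj_matrix_def adj_def)
  have x: "y * x u - (\<Sum>v\<in>pverts G. adj G u v * x v) = 1" if "u \<in> pverts G" for u
  proof -
    have "(\<Sum>v\<in>pverts G. adj G u v * x v) =
        (\<Sum>i<n. s i / (y - lam i) * (\<Sum>v\<in>pverts G. adj G u v * q i v))"
      unfolding x_def sum_distrib_left by (subst sum.swap) (simp add: mult_ac)
    also have "\<dots> = (\<Sum>i<n. s i / (y - lam i) * (lam i * q i u))"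
      using that by (intro sum.cong refl) (simp add: eigen)
    finally have "y * x u - (\<Sum>v\<in>pverts G. adj G u v * x v) =
        (\<Sum>i<n. y * (s i / (y - lam i) * q i u) - s i / (y - lam i) * (lam i * q i u))"
      by (simp add: x_def sum_distrib_left sum_subtractf)
    also have "\<dots> = (\<Sum>i<n. s i * q i u)"
    proof (intro sum.cong refl)
      fix i assume "i \<in> {..<n}"
      then have "y - lam i \<noteq> 0" using y by fastforce
      moreover have "y * (s i / (y - lam i) * q i u) - s i / (y - lam i) * (lam i * q i u) =
          (y - lam i) * (s i / (y - lam i)) * q i u"
        by (simp add: algebra_simps diff_divide_distrib)
      ultimately show "y * (s i / (y - lam i) * q i u) - s i / (y - lam i) * (lam i * q i u) =
          s i * q i u" by simp
    qed
    also have "\<dots> = 1" using expansion[OF that, of "\<lambda>_. 1"] by simp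
    finally show ?thesis .
  qed
  have BU: "(B * U) $$ (i, 0) = 1" if "i < n" for i
  proof -
    have "(B * U) $$ (i, 0) = (\<Sum>j<n. B $$ (i, j) * x (?vs ! j))"
      using that B by (simp add: U_def scalar_prod_def lessThan_atLeast0)
    also have "\<dots> = (\<Sum>j<n. (if j = i then y * x (?vs ! j) else 0) -
        adj G (?vs ! i) (?vs ! j) * x (?vs ! j))"
      using that by (intro sum.cong) (auto simp: B_index algebra_simps)
    also have "\<dots> = y * x (?vs ! i) - (\<Sum>v\<in>pverts G. adj G (?vs ! i) v * x v)"
      using that by (simp add: sum_subtractf sum_vertex_list[OF G, where f = "\<lambda>v. adj G (?vs ! i) v * x v"])
    finally show ?thesis using x vertex_list_nth_mem[OF G that] by simp
  qed
  \<comment> \<open>The left side is \<open>(J - I - A) + (1 + y) I = y I - A + J\<close>, and all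
    entries of \<open>B * U * R\<close> are one.\<close>
  have "char_matrix ?C (- 1 - y) = B + B * U * R"
  proof (rule eq_matI)
    fix i j assume "i < dim_row (B + B * U * R)" "j < dim_col (B + B * U * R)"
    then have ij: "i < n" "j < n" using B U R by auto
    have "(B * U * R) $$ (i, j) = 1"
      using ij B U BU[OF ij(1)] by (simp add: R_def scalar_prod_def)
    moreover have "?vs ! i = ?vs ! j \<longleftrightarrow> i = j"
      using ij nth_eq_iff_index_eq[OF vertex_list(1)[OF G]] by (simp add: vertex_list(3)[OF G])
    moreover have "(B + B * U * R) $$ (i, j) = B $$ (i, j) + (B * U * R) $$ (i, j)"
      using ij B U R by (intro index_add_mat) auto
    ultimately show "char_matrix ?C (- 1 - y) $$ (i, j) = (B + B * U * R) $$ (i, j)"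
      using ij vertex_list_nth_mem[OF G] pair_graph_arcD(3)[OF G, of "?vs ! j" "?vs ! j"]
      by (auto simp: char_matrix_def adj_matrix_def adj_def B_index)
  qed (use B U R C in \<open>auto simp: char_matrix_def\<close>)
  also have "\<dots> = B * (1\<^sub>m n + U * R)"
    using B U R by (simp add: mult_add_distrib_mat[of _ n n _ n] assoc_mult_mat[of _ n n _ 1 _ n])
  finally have M: "char_matrix ?C (- 1 - y) = B * (1\<^sub>m n + U * R)" .
  have "poly (compl_poly G) y = (- 1) ^ n * det (- char_matrix ?C (- 1 - y))"
    by (simp add: compl_poly_def poly_pcompose char_poly_matrix[OF C] algebra_simps)
  also have "- char_matrix ?C (- 1 - y) = (- 1) \<cdot>\<^sub>m char_matrix ?C (- 1 - y)"
    by (rule eq_matI) auto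
  also have "(- 1) ^ n * det \<dots> = det (char_matrix ?C (- 1 - y))"
    using C by (simp add: det_smult char_matrix_def power_mult_distrib[symmetric])
  also have "\<dots> = det B * det (1\<^sub>m n + U * R)"
    unfolding M using B U R by (intro det_mult) auto
  also have "det (1\<^sub>m n + U * R) = det (1\<^sub>m 1 + R * U)"
    by (rule det_one_plus_mult_commute[OF U R])
  also have "\<dots> = 1 + (\<Sum>k<n. x (?vs ! k))"
    using U R by (subst det_single) (auto simp: R_def U_def scalar_prod_def lessThan_atLeast0)
  also have "(\<Sum>k<n. x (?vs ! k)) = (\<Sum>i<n. (s i)\<^sup>2 / (y - lam i))"
    unfolding sum_vertex_list[OF G, where f = x] unfolding x_def
    by (subst sum.swap) (simp add: power2_eq_square flip: sum_distrib_left sum_divide_distrib)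
  also have "det B = poly (char_poly ?A) y"
    unfolding B_def by (rule char_poly_matrix[OF adj_matrix_carrier, symmetric])
  also have "\<dots> = (\<Prod>i<n. y - lam i)"
    by (simp add: char_poly poly_prod)
  finally show ?thesis .
qed

text \<open>Clearing denominators in \<open>poly_compl_poly\<close> shows that both sides agree at
  every real number that is not an eigenvalue, hence at infinitely many points.\<close>

lemma compl_poly_eq:
  "compl_poly G = char_poly (adj_matrix G) +
    (\<Sum>i<n. smult ((s i)\<^sup>2) (\<Prod>j\<in>{..<n} - {i}. [:- lam j, 1:]))" (is "?p = ?r")
proof (rule ccontr)
  assume "?p \<noteq> ?r"
  then have "finite {y. poly (?p - ?r) y = 0}" by (intro poly_roots_finite) simp
  moreover have "UNIV - lam ` {..<n} \<subseteq> {y. poly (?p - ?r) y = 0}"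
  proof
    fix y assume "y \<in> UNIV - lam ` {..<n}"
    then have y: "\<And>i. i < n \<Longrightarrow> lam i \<noteq> y" by auto
    have "(\<Prod>i<n. y - lam i) * ((s i)\<^sup>2 / (y - lam i)) =
        (s i)\<^sup>2 * (\<Prod>j\<in>{..<n} - {i}. y - lam j)" if "i < n" for i
      using y[OF that] that by (subst prod.remove[of _ i]) auto
    then have "poly ?p y = poly ?r y"
      by (simp add: poly_compl_poly[OF y] char_poly poly_prod poly_sum algebra_simps
          sum_distrib_left)
    then show "y \<in> {y. poly (?p - ?r) y = 0}" by simp
  qed
  ultimately have "finite (UNIV - lam ` {..<n})" by (rule rev_finite_subset)
  then show False by (simp add: infinite_UNIV_char_0)
qed

lemma char_poly_split:
  "char_poly (adj_matrix G) =
    [:- l, 1:] ^ card {i. i < n \<and> lam i = l} * (\<Prod>i | i < n \<and> lam i \<noteq> l. [:- lam i, 1:])"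
proof -
  let ?I = "{i. i < n \<and> lam i = l}" and ?J = "{i. i < n \<and> lam i \<noteq> l}"
  have "{..<n} = ?I \<union> ?J" by auto
  then have "char_poly (adj_matrix G) = (\<Prod>i\<in>?I \<union> ?J. [:- lam i, 1:])"
    unfolding char_poly by (rule arg_cong)
  also have "\<dots> = (\<Prod>i\<in>?I. [:- lam i, 1:]) * (\<Prod>i\<in>?J. [:- lam i, 1:])"
    by (rule prod.union_disjoint) auto
  also have "(\<Prod>i\<in>?I. [:- lam i, 1:]) = (\<Prod>i\<in>?I. [:- l, 1:])"
    by (rule prod.cong) auto
  finally show ?thesis by simp
qed

text \<open>
  Modulo \<open>(x - l)\<^sup>m\<close>, where \<open>m\<close> is the multiplicity of \<open>l\<close>, only those summands of
  \<open>compl_poly_eq\<close> survive that belong to \<open>l\<close>; their coefficients add up to the squared length of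
  the projection of the all-one vector to the eigenspace of \<open>l\<close>.
\<close>

lemma dvd_compl_poly_iff:
  defines "m l \<equiv> card {i. i < n \<and> lam i = l}"
  shows "[:- l, 1:] ^ m l dvd compl_poly G \<longleftrightarrow> \<not> main_eigenvalue G l"
    and "[:- l, 1:] ^ (m l - 1) dvd compl_poly G"
proof -
  let ?I = "{i. i < n \<and> lam i = l}" and ?J = "{i. i < n \<and> lam i \<noteq> l}"
  let ?t = "\<lambda>i. smult ((s i)\<^sup>2) (\<Prod>j\<in>{..<n} - {i}. [:- lam j, 1:])"
  define P where "P = (\<Prod>i\<in>?J. [:- lam i, 1:])"
  define S where "S = (\<Sum>i\<in>?I. (s i)\<^sup>2)"
  have P: "poly P l \<noteq> 0" by (auto simp: P_def poly_prod)
  have t_J: "[:- l, 1:] ^ m l dvd ?t i" if "i \<in> ?J" for i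
  proof -
    have "[:- l, 1:] ^ m l = (\<Prod>j\<in>?I. [:- lam j, 1:])" by (simp add: m_def)
    also have "\<dots> dvd (\<Prod>j\<in>{..<n} - {i}. [:- lam j, 1:])"
      using that by (intro prod_dvd_prod_subset) auto
    finally show ?thesis by (rule dvd_smult)
  qed
  have t_I: "?t i = smult ((s i)\<^sup>2) ([:- l, 1:] ^ (m l - 1) * P)" if "i \<in> ?I" for i
  proof -
    have "{..<n} - {i} = (?I - {i}) \<union> ?J" using that by auto
    then have "(\<Prod>j\<in>{..<n} - {i}. [:- lam j, 1:]) =
        (\<Prod>j\<in>?I - {i}. [:- lam j, 1:]) * P"
      unfolding P_def by (simp only:) (rule prod.union_disjoint, auto)
    also have "(\<Prod>j\<in>?I - {i}. [:- lam j, 1:]) = (\<Prod>j\<in>?I - {i}. [:- l, 1:])"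
      by (rule prod.cong) auto
    finally show ?thesis using that by (simp add: m_def card_Diff_singleton)
  qed
  have "{..<n} = ?I \<union> ?J" by auto
  then have "(\<Sum>i<n. ?t i) = (\<Sum>i\<in>?I. ?t i) + (\<Sum>i\<in>?J. ?t i)"
    by (simp only:) (rule sum.union_disjoint, auto)
  also have "(\<Sum>i\<in>?I. ?t i) = (\<Sum>i\<in>?I. smult ((s i)\<^sup>2) ([:- l, 1:] ^ (m l - 1) * P))"
    by (rule sum.cong[OF refl t_I])
  also have "\<dots> = smult S ([:- l, 1:] ^ (m l - 1) * P)"
    by (simp add: S_def smult_sum)
  finally have compl: "compl_poly G =
      (char_poly (adj_matrix G) + (\<Sum>i\<in>?J. ?t i)) + smult S ([:- l, 1:] ^ (m l - 1) * P)"
    by (simp add: compl_poly_eq)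
  have rest: "[:- l, 1:] ^ m l dvd char_poly (adj_matrix G) + (\<Sum>i\<in>?J. ?t i)"
    using char_poly_split[of l] by (intro dvd_add dvd_sum t_J) (auto simp: m_def)
  \<comment> \<open>A sum of real squares vanishes only if every summand does, so several
    eigenvectors for \<open>l\<close> cannot cancel each other.\<close>
  have S: "S \<noteq> 0 \<longleftrightarrow> main_eigenvalue G l"
    by (auto simp: S_def main_eigenvalue_iff_coeff sum_nonneg_eq_0_iff)
  \<comment> \<open>For \<open>m l = 0\<close> truncated subtraction makes \<open>m l - 1\<close>
    equal to \<open>m l\<close>, so the powers no longer differ; this case is harmless because
    \<open>S\<close> is then an empty sum.\<close>
  have m: "S = 0" if "m l = 0"
  proof -
    have "?I = {}" using that by (auto simp: m_def)
    then show ?thesis unfolding S_def by (simp only: sum.empty)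
  qed
  have "[:- l, 1:] ^ m l dvd compl_poly G \<longleftrightarrow>
      [:- l, 1:] ^ m l dvd smult S ([:- l, 1:] ^ (m l - 1) * P)"
    unfolding compl by (rule dvd_add_right_iff[OF rest])
  also have "\<dots> \<longleftrightarrow> S = 0"
  proof
    show "S = 0" if dvd: "[:- l, 1:] ^ m l dvd smult S ([:- l, 1:] ^ (m l - 1) * P)"
    proof (rule ccontr)
      assume "S \<noteq> 0"
      with m obtain k where k: "m l = Suc k" by (cases "m l") auto
      have "[:- l, 1:] ^ k * [:- l, 1:] dvd [:- l, 1:] ^ k * P"
        using dvd_smult_cancel[OF dvd \<open>S \<noteq> 0\<close>] by (simp only: k power_Suc2 diff_Suc_1)
      moreover have "[:- l, 1:] ^ k \<noteq> 0" by simp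
      ultimately have "[:- l, 1:] dvd P" using dvd_mult_cancel_left by blast
      with P show False by (simp add: poly_eq_0_iff_dvd)
    qed
  qed simp
  finally show "[:- l, 1:] ^ m l dvd compl_poly G \<longleftrightarrow> \<not> main_eigenvalue G l"
    using S by blast
  have "[:- l, 1:] ^ (m l - 1) dvd char_poly (adj_matrix G) + (\<Sum>i\<in>?J. ?t i)"
    using rest by (rule dvd_trans[OF le_imp_power_dvd, rotated]) simp
  then show "[:- l, 1:] ^ (m l - 1) dvd compl_poly G"
    unfolding compl by (rule dvd_add) (simp add: dvd_smult)
qed

end

section \<open>Rationality of the main polynomial\<close>

text \<open>Induction on the factors: the linear polynomial of the new index either divides
  \<open>p\<close> and cancels, or it divides the cofactor. An index set instead of a set of roots
  keeps track of repeated factors.\<close>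

lemma monic_dvd_prod_linear:
  fixes p :: "'a :: field poly" and lam :: "'b \<Rightarrow> 'a"
  assumes "finite A" "monic p" "p dvd (\<Prod>i\<in>A. [:- lam i, 1:])"
  shows "\<exists>I\<subseteq>A. p = (\<Prod>i\<in>I. [:- lam i, 1:])"
  using assms
proof (induction A arbitrary: p rule: finite_induct)
  case empty
  then have "degree p = 0" using dvd_imp_degree_le[of p 1] by simp
  then have "p = 1" using empty monic_degree_0 by blast
  then show ?case by (intro exI[of _ "{}"]) simp
next
  case (insert a A)
  let ?L = "[:- lam a, 1:]" and ?Q = "\<Prod>i\<in>A. [:- lam i, 1:]"
  have dvd: "p dvd ?L * ?Q" using insert by (simp add: mult.commute)
  show ?case
  proof (cases "?L dvd p")
    case True
    then obtain r where r: "p = ?L * r" by (rule dvdE)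
    then have "monic r" using insert.prems(1) monic_factor[of ?L r] r by simp
    moreover have "r dvd ?Q" using dvd unfolding r by (subst (asm) dvd_mult_cancel_left) auto
    ultimately obtain I where I: "I \<subseteq> A" "r = (\<Prod>i\<in>I. [:- lam i, 1:])"
      using insert.IH by blast
    then have "finite I" "a \<notin> I" using insert.hyps by (auto intro: finite_subset)
    then have "p = (\<Prod>i\<in>insert a I. [:- lam i, 1:])" unfolding r I(2) by simp
    then show ?thesis using I(1) by blast
  next
    case False
    obtain r where r: "?L * ?Q = p * r" using dvd by (rule dvdE)
    have "poly (p * r) (lam a) = 0" by (simp flip: r)
    with False have "?L dvd r" by (simp add: poly_eq_0_iff_dvd)
    then obtain r' where "r = ?L * r'" by (rule dvdE)
    then have "?L * ?Q = ?L * (p * r')" using r by (simp only: mult_ac)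
    then have "?Q = p * r'" by (subst (asm) mult_cancel_left) auto
    then have "p dvd ?Q" by simp
    then obtain I where "I \<subseteq> A" "p = (\<Prod>i\<in>I. [:- lam i, 1:])"
      using insert.IH insert.prems(1) by blast
    then show ?thesis by blast
  qed
qed

interpretation real_of_rat_poly: map_poly_inj_idom_hom real_of_rat ..

text \<open>Both arguments of the gcd are rational polynomials determined by the two spectra, so
  rationality and invariance are built in; that the quotient is the main polynomial is
  \<open>map_main_rat\<close>.\<close>

definition main_rat :: "'a pair_pre_digraph \<Rightarrow> rat poly" where
  "main_rat G = graph_poly G div gcd (graph_poly G) (compl_poly G)"

lemma monic_graph_char_poly: "monic (char_poly (adj_matrix G))"
  by (metis degree_monic_char_poly[OF adj_matrix_carrier])

lemma graph_char_poly_nonzero: "char_poly (adj_matrix G) \<noteq> (0 :: 'r :: comm_ring_1 poly)"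
  using monic_graph_char_poly[of G, where 'a = 'r] by auto

lemma main_rat_mult_gcd: "graph_poly G = main_rat G * gcd (graph_poly G) (compl_poly G)"
  by (simp add: main_rat_def)

lemma monic_main_rat: "monic (main_rat G)"
proof -
  have "monic (gcd (graph_poly G) (compl_poly G))"
    by (rule poly_gcd_monic) (simp add: graph_char_poly_nonzero)
  then show ?thesis
    using monic_graph_char_poly[of G, where 'a = rat] main_rat_mult_gcd[of G]
    by (metis lead_coeff_mult mult.right_neutral)
qed

lemma main_rat_dvd: "main_rat G dvd graph_poly G"
  using main_rat_mult_gcd by (metis dvd_triv_left)

text \<open>If \<open>l\<close> has multiplicity \<open>m\<close> in the characteristic polynomial,
  then its multiplicity in \<open>compl_poly G\<close> is \<open>m - 1\<close> if it is main and at
  least \<open>m\<close> otherwise; the gcd takes the minimum.\<close>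

lemma (in graph_eigenbasis) order_main_rat:
  "order l (map_poly real_of_rat (main_rat G)) = (if main_eigenvalue G l then 1 else 0)"
proof -
  let ?h = "map_poly real_of_rat" and ?X = "[:- l, 1:]"
  let ?phi = "char_poly (adj_matrix G) :: real poly" and ?psi = "compl_poly G :: real poly"
  define d where "d = gcd (graph_poly G) (compl_poly G)"
  define m where "m = card {i. i < n \<and> lam i = l}"
  have phi: "?h (graph_poly G) = ?phi" and psi: "?h (compl_poly G) = ?psi"
    by (rule of_rat_hom.map_graph_char_poly of_rat_hom.map_compl_poly)+
  have d_nz: "?h d \<noteq> 0" and M_nz: "?h (main_rat G) \<noteq> 0"
    using graph_char_poly_nonzero[of G, where 'r = rat] main_rat_mult_gcd[of G]
    by (auto simp: d_def)
  have phi_mult: "?phi = ?h (main_rat G) * ?h d"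
    unfolding phi[symmetric] d_def
    by (subst main_rat_mult_gcd) (simp only: real_of_rat_poly.hom_mult)
  then have order_sum: "m = order l (?h (main_rat G)) + order l (?h d)"
    using order_char_poly[of l] d_nz M_nz by (simp add: m_def order_mult)
  have dvd_d: "p dvd ?h d \<longleftrightarrow> p dvd ?phi \<and> p dvd ?psi" for p
  proof
    assume "p dvd ?h d"
    moreover have "?h d dvd ?phi" "?h d dvd ?psi"
      unfolding phi[symmetric] psi[symmetric] d_def by (intro real_of_rat_poly.hom_dvd; simp)+
    ultimately show "p dvd ?phi \<and> p dvd ?psi" using dvd_trans by blast
  next
    \<comment> \<open>A Bezout representation shows that the gcd computed over the rationals is
      still a greatest common divisor over the reals.\<close>
    obtain u v where "d = u * graph_poly G + v * compl_poly G"
      unfolding d_def using bezout_coefficients_fst_snd by metis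
    then have "?h d = ?h u * ?phi + ?h v * ?psi"
      by (simp add: hom_distribs phi psi)
    moreover assume "p dvd ?phi \<and> p dvd ?psi"
    ultimately show "p dvd ?h d" by simp
  qed
  have X_phi: "?X ^ k dvd ?phi \<longleftrightarrow> k \<le> m" for k
    using order_char_poly[of l] graph_char_poly_nonzero[of G, where 'r = real]
    unfolding order_divides m_def by simp
  have le_order: "k \<le> order l (?h d) \<longleftrightarrow> k \<le> m \<and> ?X ^ k dvd ?psi" for k
    using dvd_d[of "?X ^ k"] d_nz X_phi[of k] order_divides[of l k "?h d"] by blast
  show ?thesis
  proof (cases "main_eigenvalue G l")
    case True
    then have "m \<noteq> 0" by (auto simp: main_eigenvalue_iff_coeff m_def)
    moreover have "m - 1 \<le> order l (?h d)"
      unfolding le_order m_def using dvd_compl_poly_iff(2)[of l] by auto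
    moreover have "\<not> m \<le> order l (?h d)"
      unfolding le_order m_def using dvd_compl_poly_iff(1)[of l] True by blast
    ultimately show ?thesis using order_sum True by simp
  next
    case False
    then have "m \<le> order l (?h d)"
      unfolding le_order m_def using dvd_compl_poly_iff(1)[of l] by blast
    then show ?thesis using order_sum False by simp
  qed
qed

lemma finite_main_eigenvalues:
  assumes "pair_graph G"
  shows "finite {l. main_eigenvalue G l}"
proof -
  obtain q lam where "graph_eigenbasis G q lam" using ex_graph_eigenbasis[OF assms] .
  then interpret graph_eigenbasis G q lam .
  have "{l. main_eigenvalue G l} \<subseteq> lam ` {..<n}"
    by (auto simp: main_eigenvalue_iff_coeff)
  then show ?thesis by (rule finite_subset) simp
qed

text \<open>Both are monic products of real linear factors with the same roots, and
  \<open>order_main_rat\<close> excludes repetitions.\<close>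

lemma map_main_rat:
  assumes "pair_graph G"
  shows "map_poly real_of_rat (main_rat G) = main_poly G"
proof -
  obtain q lam where "graph_eigenbasis G q lam" using ex_graph_eigenbasis[OF assms] .
  then interpret graph_eigenbasis G q lam .
  let ?M = "map_poly real_of_rat (main_rat G)"
  have "monic ?M" using monic_main_rat[of G] by simp
  moreover have "?M dvd (\<Prod>i<n. [:- lam i, 1:])"
    using real_of_rat_poly.hom_dvd[OF main_rat_dvd[of G]]
    by (simp only: of_rat_hom.map_graph_char_poly char_poly)
  ultimately obtain I where I: "I \<subseteq> {..<n}" and M: "?M = (\<Prod>i\<in>I. [:- lam i, 1:])"
    using monic_dvd_prod_linear[of "{..<n}"] by blast
  have fin_I: "finite I" using I by (rule finite_subset) simp
  have inj: "inj_on lam I"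
  proof (rule inj_onI, rule ccontr)
    fix i j assume ij: "i \<in> I" "j \<in> I" "lam i = lam j" "i \<noteq> j"
    have "(\<Prod>k\<in>{i, j}. [:- lam k, 1:]) dvd ?M"
      unfolding M using ij fin_I by (intro prod_dvd_prod_subset) auto
    then have "[:- lam i, 1:] ^ 2 dvd ?M" using ij by (simp add: power2_eq_square)
    then have "2 \<le> order (lam i) ?M"
      using \<open>monic ?M\<close> by (subst (asm) order_divides) auto
    then show False by (simp add: order_main_rat split: if_splits)
  qed
  have "?M = (\<Prod>l\<in>lam ` I. [:- l, 1:])"
    unfolding M using inj by (simp add: prod.reindex)
  also have "lam ` I = {l. main_eigenvalue G l}"
  proof -
    have "l \<in> lam ` I \<longleftrightarrow> main_eigenvalue G l" for l
    proof -
      have "l \<in> lam ` I \<longleftrightarrow> poly ?M l = 0"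
        unfolding M using fin_I by (auto simp: poly_prod)
      also have "\<dots> \<longleftrightarrow> order l ?M \<noteq> 0"
        using \<open>monic ?M\<close> by (subst order_root) auto
      finally show ?thesis by (simp add: order_main_rat)
    qed
    then show ?thesis by blast
  qed
  finally show ?thesis by (simp add: main_poly_def)
qed

lemma poly_main_poly_eq_0_iff:
  "pair_graph G \<Longrightarrow> poly (main_poly G) l = 0 \<longleftrightarrow> main_eigenvalue G l"
  using finite_main_eigenvalues[of G] by (auto simp: main_poly_def poly_prod)

text \<open>The all-one vector of a nonempty graph has positive length, so one of its coefficients
  in the eigenbasis is nonzero.\<close>

lemma ex_main_eigenvalue:
  assumes G: "pair_graph G" and ne: "pverts G \<noteq> {}"
  shows "\<exists>l. main_eigenvalue G l"
proof -
  obtain q lam where "graph_eigenbasis G q lam" using ex_graph_eigenbasis[OF G] .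
  then interpret graph_eigenbasis G q lam .
  have "(\<Sum>i<n. s i * s i) = real n"
    using parseval[of "\<lambda>_. 1" "\<lambda>_. 1"] by simp
  also have "\<dots> \<noteq> 0" using ne fin by simp
  finally obtain i where "i \<in> {..<n}" "s i * s i \<noteq> 0"
    by (rule sum.not_neutral_contains_not_neutral)
  then show ?thesis by (auto simp: main_eigenvalue_iff_coeff)
qed

text \<open>The spectra are real, so equal spectra mean equal characteristic polynomials.\<close>

lemma adj_spectrum_eq_imp_char_poly_eq:
  assumes G: "pair_graph G" and H: "pair_graph H" and eq: "adj_spectrum G = adj_spectrum H"
  shows "graph_poly G = graph_poly H" "card (pverts G) = card (pverts H)"
proof -
  have *: "char_poly (adj_matrix K) = (\<Prod>l\<in>#adj_spectrum K. [:- l, 1:])"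
    "card (pverts K) = size (adj_spectrum K)" if K: "pair_graph K" for K :: "'c pair_pre_digraph"
  proof -
    obtain q lam where "graph_eigenbasis K q lam" using ex_graph_eigenbasis[OF K] .
    then interpret graph_eigenbasis K q lam .
    show "char_poly (adj_matrix K) = (\<Prod>l\<in>#adj_spectrum K. [:- l, 1:])"
      unfolding adj_spectrum_def proots_char_poly
      by (simp add: char_poly prod_unfold_prod_mset multiset.map_comp o_def)
    show "card (pverts K) = size (adj_spectrum K)"
      by (simp add: adj_spectrum_def proots_char_poly)
  qed
  show "card (pverts G) = card (pverts H)" using *(2)[OF G] *(2)[OF H] eq by simp
  have "map_poly real_of_rat (graph_poly G) = map_poly real_of_rat (graph_poly H)"
    unfolding of_rat_hom.map_graph_char_poly *(1)[OF G] *(1)[OF H] eq ..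
  then show "graph_poly G = graph_poly H" by (rule real_of_rat_poly.injectivity)
qed

lemma generalized_cospectralD:
  assumes G: "pair_graph G" and H: "pair_graph H" and "generalized_cospectral G H"
  shows "graph_poly G = graph_poly H" "card (pverts G) = card (pverts H)"
    "main_poly G = main_poly H"
proof -
  have eq: "adj_spectrum G = adj_spectrum H"
    "adj_spectrum (complement_graph G) = adj_spectrum (complement_graph H)"
    using assms(3) by (simp_all add: generalized_cospectral_def)
  note 1 = adj_spectrum_eq_imp_char_poly_eq[OF G H eq(1)]
  note 2 = adj_spectrum_eq_imp_char_poly_eq[OF pair_graph_complement[OF G]
      pair_graph_complement[OF H] eq(2)]
  from 1 show "graph_poly G = graph_poly H" "card (pverts G) = card (pverts H)" .
  have "main_rat G = main_rat H"
    unfolding main_rat_def compl_poly_def 1 2(1) ..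
  then show "main_poly G = main_poly H"
    by (simp flip: map_main_rat[OF G] map_main_rat[OF H])
qed

section \<open>Closed walks and the Perron eigenvalue\<close>

text \<open>The entries of the powers of the adjacency matrix, taken as reals for the comparison
  with power sums of eigenvalues.\<close>

primrec walk_count :: "'a pair_pre_digraph \<Rightarrow> nat \<Rightarrow> 'a \<Rightarrow> 'a \<Rightarrow> real" where
  "walk_count G 0 u v = (if u = v then 1 else 0)"
| "walk_count G (Suc k) u v = (\<Sum>w\<in>pverts G. adj G u w * walk_count G k w v)"

lemma walk_count_nonneg: "0 \<le> walk_count G k u v"
  by (induction k arbitrary: u) (auto simp: adj_def intro!: sum_nonneg)

text \<open>All summands are nonnegative, so nothing cancels. This turns a vanishing trace into the
  absence of closed walks.\<close>

lemma walk_count_eq_0_iff: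
  assumes G: "pair_graph G"
  shows "walk_count G k u v = 0 \<longleftrightarrow> (u, v) \<notin> parcs G ^^ k"
proof (induction k arbitrary: u)
  case (Suc k)
  have "walk_count G (Suc k) u v = 0 \<longleftrightarrow>
      (\<forall>w\<in>pverts G. adj G u w * walk_count G k w v = 0)"
    by (simp add: sum_nonneg_eq_0_iff pair_graph_finite[OF G] walk_count_nonneg adj_def)
  also have "\<dots> \<longleftrightarrow> (\<forall>w. (u, w) \<in> parcs G \<longrightarrow> (w, v) \<notin> parcs G ^^ k)"
    using pair_graph_arcD(2)[OF G] by (auto simp: adj_def Suc.IH)
  also have "\<dots> \<longleftrightarrow> (u, v) \<notin> parcs G ^^ Suc k"
    by (metis relpow_Suc_D2 relpow_Suc_I2)
  finally show ?case .
qed simp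

text \<open>A closed walk of length two runs along an arc and back, so there is exactly one for each
  arc.\<close>

lemma trace_2:
  assumes G: "pair_graph G"
  shows "(\<Sum>u\<in>pverts G. walk_count G 2 u u) = card (parcs G)"
proof -
  have "(\<Sum>u\<in>pverts G. walk_count G 2 u u) = (\<Sum>u\<in>pverts G. \<Sum>w\<in>pverts G. adj G u w)"
  proof (intro sum.cong refl)
    fix u w assume u: "u \<in> pverts G"
    have "(\<Sum>x\<in>pverts G. adj G w x * walk_count G 0 x u) = adj G w u" for w
      using u pair_graph_finite[OF G] by (simp add: if_distrib[of "\<lambda>c. _ * c"] cong: if_cong)
    then show "walk_count G 2 u u = (\<Sum>w\<in>pverts G. adj G u w)"
      by (simp add: numeral_2_eq_2 adj_def pair_graph_sym[OF G] cong: if_cong)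
        (auto simp: adj_def intro!: sum.cong dest: pair_graph_sym[OF G])
  qed
  also have "\<dots> = (\<Sum>e\<in>pverts G \<times> pverts G. if e \<in> parcs G then 1 else 0)"
    by (simp add: sum.cartesian_product adj_def)
  also have "\<dots> = card ((pverts G \<times> pverts G) \<inter> parcs G)"
    using pair_graph_finite[OF G] by (simp add: sum.If_cases Int_def)
  also have "(pverts G \<times> pverts G) \<inter> parcs G = parcs G"
    using pair_graph_arcD[OF G] by auto
  finally show ?thesis .
qed

context graph_eigenbasis
begin

lemma walk_count_eq:
  assumes "u \<in> pverts G" "v \<in> pverts G"
  shows "walk_count G k u v = (\<Sum>i<n. lam i ^ k * q i u * q i v)"
  using assms(1)
proof (induction k arbitrary: u)
  case 0
  then show ?case using complete assms(2) by simp
next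
  case (Suc k)
  have "walk_count G (Suc k) u v =
      (\<Sum>w\<in>pverts G. adj G u w * (\<Sum>i<n. lam i ^ k * q i w * q i v))"
    by (simp add: Suc.IH)
  also have "\<dots> = (\<Sum>i<n. lam i ^ k * q i v * (\<Sum>w\<in>pverts G. adj G u w * q i w))"
    unfolding sum_distrib_left by (subst sum.swap) (simp add: mult_ac)
  also have "\<dots> = (\<Sum>i<n. lam i ^ Suc k * q i u * q i v)"
    using Suc.prems by (intro sum.cong refl) (simp add: eigen)
  finally show ?case .
qed

lemma trace_eq: "(\<Sum>u\<in>pverts G. walk_count G k u u) = (\<Sum>l\<in>#adj_spectrum G. l ^ k)"
proof -
  have "(\<Sum>u\<in>pverts G. walk_count G k u u) = (\<Sum>u\<in>pverts G. \<Sum>i<n. lam i ^ k * (q i u * q i u))"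
    by (intro sum.cong refl) (simp add: walk_count_eq mult.assoc)
  also have "\<dots> = (\<Sum>i<n. lam i ^ k * (\<Sum>u\<in>pverts G. q i u * q i u))"
    by (subst sum.swap) (simp add: sum_distrib_left)
  also have "\<dots> = (\<Sum>i<n. lam i ^ k)"
    by (intro sum.cong refl) (simp add: orth)
  finally show ?thesis
    unfolding adj_spectrum_def proots_char_poly
    by (simp add: sum_unfold_sum_mset multiset.map_comp o_def)
qed

section \<open>The largest eigenvalue of a connected graph\<close>

lemma adj_expansion:
  assumes "u \<in> pverts G"
  shows "(\<Sum>v\<in>pverts G. adj G u v * x v) =
    (\<Sum>i<n. lam i * (\<Sum>v\<in>pverts G. x v * q i v) * q i u)"
  using expansion[OF assms, of "\<lambda>u. \<Sum>v\<in>pverts G. adj G u v * x v"] by (simp add: coeff_adj)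

text \<open>
  If \<open>x\<close> is an eigenvector for the largest eigenvalue, so is \<open>\<bar>x\<bar>\<close>, since its Rayleigh quotient
  is at least as large.
\<close>

lemma abs_max_eigenvector:
  assumes max: "\<And>i. i < n \<Longrightarrow> lam i \<le> l"
    and x: "\<And>u. u \<in> pverts G \<Longrightarrow> (\<Sum>v\<in>pverts G. adj G u v * x v) = l * x u"
    and u: "u \<in> pverts G"
  shows "(\<Sum>v\<in>pverts G. adj G u v * \<bar>x v\<bar>) = l * \<bar>x u\<bar>"
proof -
  define c where "c i = (\<Sum>v\<in>pverts G. \<bar>x v\<bar> * q i v)" for i
  define y where "y u = (\<Sum>v\<in>pverts G. adj G u v * \<bar>x v\<bar>)" for u
  have "l * (\<Sum>i<n. c i * c i) = l * (\<Sum>u\<in>pverts G. x u * x u)"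
    using parseval[of "\<lambda>u. \<bar>x u\<bar>" "\<lambda>u. \<bar>x u\<bar>"] by (simp add: c_def)
  also have "\<dots> = (\<Sum>u\<in>pverts G. (\<Sum>v\<in>pverts G. adj G u v * x v) * x u)"
    by (simp add: x sum_distrib_left mult.assoc)
  also have "\<dots> \<le> (\<Sum>u\<in>pverts G. y u * \<bar>x u\<bar>)"
  proof (intro sum_mono)
    fix u
    have "(\<Sum>v\<in>pverts G. adj G u v * x v) * x u \<le> \<bar>\<Sum>v\<in>pverts G. adj G u v * x v\<bar> * \<bar>x u\<bar>"
      by (metis abs_ge_self abs_mult)
    also have "\<bar>\<Sum>v\<in>pverts G. adj G u v * x v\<bar> \<le> y u"
      unfolding y_def by (rule order_trans[OF sum_abs]) (auto simp: abs_mult adj_def intro!: sum_mono)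
    finally show "(\<Sum>v\<in>pverts G. adj G u v * x v) * x u \<le> y u * \<bar>x u\<bar>"
      by (simp add: mult_right_mono)
  qed
  also have "\<dots> = (\<Sum>i<n. lam i * c i * c i)"
    by (subst parseval) (simp add: y_def c_def coeff_adj)
  finally have "(\<Sum>i<n. (l - lam i) * (c i * c i)) \<le> 0"
    by (simp add: left_diff_distrib sum_subtractf sum_distrib_left mult.assoc)
  \<comment> \<open>Every summand is nonnegative because \<open>l\<close> is the maximum. Equality
    means that \<open>\<bar>x\<bar>\<close> has nonzero coefficients only where
    \<open>lam i = l\<close>.\<close>
  then have "(\<Sum>i<n. (l - lam i) * (c i * c i)) = 0"
    using max by (intro antisym sum_nonneg) auto
  then have c: "(l - lam i) * (c i * c i) = 0" if "i < n" for i
    using max that by (subst (asm) sum_nonneg_eq_0_iff) auto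
  have "(\<Sum>v\<in>pverts G. adj G u v * \<bar>x v\<bar>) = (\<Sum>i<n. lam i * c i * q i u)"
    using adj_expansion[OF u, of "\<lambda>v. \<bar>x v\<bar>"] by (simp add: c_def)
  also have "\<dots> = (\<Sum>i<n. l * (c i * q i u))"
    using c by (intro sum.cong refl) auto
  also have "\<dots> = l * \<bar>x u\<bar>"
    using expansion[OF u, of "\<lambda>v. \<bar>x v\<bar>"] by (simp add: c_def flip: sum_distrib_left)
  finally show ?thesis .
qed

text \<open>At a zero of the eigenvector the absolute values over its neighbours sum to zero, so
  zeros spread along arcs.\<close>

lemma max_eigenvector_no_zero:
  assumes conn: "\<And>u v. u \<in> pverts G \<Longrightarrow> v \<in> pverts G \<Longrightarrow> (u, v) \<in> (parcs G)\<^sup>*"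
    and max: "\<And>i. i < n \<Longrightarrow> lam i \<le> l"
    and x: "\<And>u. u \<in> pverts G \<Longrightarrow> (\<Sum>v\<in>pverts G. adj G u v * x v) = l * x u"
    and u: "u \<in> pverts G" "x u = 0" and v: "v \<in> pverts G"
  shows "x v = 0"
  using conn[OF u(1) v]
proof (induction rule: rtrancl_induct)
  case (step w z)
  have wz: "w \<in> pverts G" "z \<in> pverts G" using pair_graph_arcD[OF G step(2)] by auto
  have "(\<Sum>v\<in>pverts G. adj G w v * \<bar>x v\<bar>) = 0"
    using abs_max_eigenvector[OF max x wz(1)] step.IH by simp
  then have "adj G w z * \<bar>x z\<bar> = 0"
    using wz fin by (subst (asm) sum_nonneg_eq_0_iff) (auto simp: adj_def)
  then show ?case using step(2) by (simp add: adj_def)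
qed (fact u(2))

end

text \<open>The absolute value of an eigenvector for the largest eigenvalue is again one, and its
  entries have positive sum. Simplicity holds because an eigenvector for this eigenvalue with a
  single zero vanishes everywhere.\<close>

theorem perron_main_eigenvalue:
  assumes G: "pair_graph G" and ne: "pverts G \<noteq> {}"
    and conn: "\<And>u v. u \<in> pverts G \<Longrightarrow> v \<in> pverts G \<Longrightarrow> (u, v) \<in> (parcs G)\<^sup>*"
  obtains l where "main_eigenvalue G l" "order l (char_poly (adj_matrix G)) = 1"
proof -
  obtain q lam where "graph_eigenbasis G q lam" using ex_graph_eigenbasis[OF G] .
  then interpret graph_eigenbasis G q lam .
  have "n \<noteq> 0" using ne fin by simp
  define l where "l = Max (lam ` {..<n})"
  have max: "lam i \<le> l" if "i < n" for i using that by (simp add: l_def)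
  have "l \<in> lam ` {..<n}" unfolding l_def using \<open>n \<noteq> 0\<close> by (intro Max_in) auto
  then obtain j where j: "j < n" "lam j = l" by auto
  have q_nz: "\<exists>u\<in>pverts G. q i u \<noteq> 0" if "i < n" for i
    using orth[OF that that] by (metis (no_types, lifting) mult_zero_left sum.neutral zero_neq_one)
  have eigen_l: "(\<Sum>v\<in>pverts G. adj G u v * q i v) = l * q i u"
    if "i < n" "lam i = l" "u \<in> pverts G" for i u using eigen that by simp
  have "main_eigenvalue G l"
    unfolding main_eigenvalue_iff[OF G]
  proof (intro exI[of _ "\<lambda>v. \<bar>q j v\<bar>"] conjI ballI)
    show "(\<Sum>v\<in>pverts G. adj G u v * \<bar>q j v\<bar>) = l * \<bar>q j u\<bar>" if "u \<in> pverts G" for u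
      using abs_max_eigenvector[OF max eigen_l[OF j] that] .
    show "(\<Sum>u\<in>pverts G. \<bar>q j u\<bar>) \<noteq> 0"
      using q_nz[OF j(1)] fin by (simp add: sum_nonneg_eq_0_iff)
  qed
  moreover have "i = j" if i: "i < n" "lam i = l" for i
  proof (rule ccontr)
    assume "i \<noteq> j"
    obtain u where u: "u \<in> pverts G" "q i u \<noteq> 0" using q_nz[OF i(1)] by blast
    \<comment> \<open>The combination is chosen to vanish at \<open>u\<close>; once it vanishes
      everywhere, its inner product with \<open>q j\<close> shows \<open>q i u = 0\<close>.\<close>
    define x where "x v = q i u * q j v - q j u * q i v" for v
    have "(\<Sum>v\<in>pverts G. adj G w v * x v) = l * x w" if "w \<in> pverts G" for w
    proof -
      have "(\<Sum>v\<in>pverts G. adj G w v * x v) =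
          q i u * (\<Sum>v\<in>pverts G. adj G w v * q j v) - q j u * (\<Sum>v\<in>pverts G. adj G w v * q i v)"
        by (simp add: x_def sum_distrib_left algebra_simps sum_subtractf)
      also have "\<dots> = l * x w"
        unfolding eigen_l[OF i that] eigen_l[OF j that] by (simp add: x_def algebra_simps)
      finally show ?thesis .
    qed
    then have "x v = 0" if "v \<in> pverts G" for v
      using max_eigenvector_no_zero[OF conn max, of x u v] u(1) that by (simp add: x_def)
    then have "0 = (\<Sum>v\<in>pverts G. x v * q j v)" by simp
    also have "\<dots> = q i u * (\<Sum>v\<in>pverts G. q j v * q j v) - q j u * (\<Sum>v\<in>pverts G. q i v * q j v)"
      by (simp add: x_def sum_distrib_left algebra_simps sum_subtractf)
    also have "\<dots> = q i u" using orth i j \<open>i \<noteq> j\<close> by simp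
    finally show False using u by simp
  qed
  then have "{i. i < n \<and> lam i = l} = {j}" using j by blast
  then have "order l (char_poly (adj_matrix G)) = 1" by (simp add: order_char_poly)
  ultimately show thesis by (rule that)
qed

section \<open>Cycles, trees and bipartiteness\<close>

text \<open>The symmetric closure changes nothing for symmetric arcs, and a path that starts at a
  vertex stays inside the vertex set.\<close>

lemma connected_iff:
  assumes G: "pair_graph G"
  shows "Digraph_Component.connected (with_proj G) \<longleftrightarrow>
    pverts G \<noteq> {} \<and> (\<forall>u\<in>pverts G. \<forall>v\<in>pverts G. (u, v) \<in> (parcs G)\<^sup>*)"
proof -
  have arcs: "parcs (mk_symmetric (with_proj G)) = parcs G"
    using pair_graph_sym[OF G] by (auto simp: parcs_mk_symmetric)
  have "(u, v) \<in> rtrancl_on (pverts G) (parcs G) \<longleftrightarrow> (u, v) \<in> (parcs G)\<^sup>*"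
    if "u \<in> pverts G" for u v
  proof
    assume "(u, v) \<in> (parcs G)\<^sup>*"
    then show "(u, v) \<in> rtrancl_on (pverts G) (parcs G)"
      by induction (use that pair_graph_arcD[OF G] in \<open>auto intro: rtrancl_on_into_rtrancl_on\<close>)
  qed (rule rtrancl_on_rtranclI)
  then show ?thesis
    by (simp add: connected_def strongly_connected_def reachable_def arcs)
qed

lemma pcas_append: "pcas u (p @ r) v \<longleftrightarrow> (\<exists>w. pcas u p w \<and> pcas w r v)"
  by (induction p arbitrary: u) auto

lemma pcas_last: "pcas u p v \<Longrightarrow> p \<noteq> [] \<Longrightarrow> v \<in> set (map snd p)"
  by (induction p arbitrary: u) (auto, (case_tac p; auto)+)

lemma pcas_imp_rtrancl: "pcas u p v \<Longrightarrow> set p \<subseteq> A \<Longrightarrow> (u, v) \<in> A\<^sup>*"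
  by (induction p arbitrary: u) (auto intro: converse_rtrancl_into_rtrancl)

lemma pawalk_verts_pcas: "pcas u p v \<Longrightarrow> pawalk_verts u p = u # map snd p"
  by (induction p arbitrary: u) auto

lemma cycle_iff:
  "pre_digraph.cycle (with_proj G) p \<longleftrightarrow>
    (\<exists>u\<in>pverts G. set p \<subseteq> parcs G \<and> pcas u p u \<and> distinct (map snd p) \<and> p \<noteq> [])"
  by (auto simp: pre_digraph.cycle_def pre_digraph.awalk_def cas_with_proj_eq
      awalk_verts_with_proj_eq pawalk_verts_pcas)

text \<open>Prepending an arc keeps a path simple unless its start is visited already; then the tail
  after that visit is kept instead.\<close>

lemma rtrancl_imp_simple_path:
  assumes "(u, v) \<in> A\<^sup>*"
  shows "\<exists>p. pcas u p v \<and> set p \<subseteq> A \<and> distinct (u # map snd p)"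
  using assms
proof (induction rule: converse_rtrancl_induct)
  case base
  show ?case by (intro exI[of _ "[]"]) simp
next
  case (step u w)
  then obtain p where p: "pcas w p v" "set p \<subseteq> A" "distinct (w # map snd p)" by blast
  show ?case
  proof (cases "u \<in> set (w # map snd p)")
    case False
    with p step.hyps show ?thesis by (intro exI[of _ "(u, w) # p"]) auto
  next
    case True
    show ?thesis
    proof (cases "u = w")
      case False
      with True obtain x where "(x, u) \<in> set p" by auto
      then obtain p1 p2 where "p = p1 @ (x, u) # p2" by (meson split_list)
      with p show ?thesis by (intro exI[of _ p2]) (auto simp: pcas_append)
    qed (use p in blast)
  qed
qed

section \<open>Cycles and the deletion of an edge\<close>

definition del_edge :: "'a \<Rightarrow> 'a \<Rightarrow> 'a pair_pre_digraph \<Rightarrow> 'a pair_pre_digraph" where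
  "del_edge a b G = \<lparr>pverts = pverts G, parcs = parcs G - {(a, b), (b, a)}\<rparr>"

lemma del_edge_simps [simp]:
  "pverts (del_edge a b G) = pverts G" "parcs (del_edge a b G) = parcs G - {(a, b), (b, a)}"
  by (simp_all add: del_edge_def)

lemma pair_graph_del_edge: "pair_graph G \<Longrightarrow> pair_graph (del_edge a b G)"
  by (rule pair_graphI) (auto simp: pair_graph_finite pair_graph_sym dest: pair_graph_arcD)

lemma sym_parcs: "pair_graph G \<Longrightarrow> sym (parcs G)"
  by (auto intro!: symI dest: pair_graph_sym)

lemma card_del_edge:
  assumes "pair_graph G" "(a, b) \<in> parcs G"
  shows "card (parcs G) = card (parcs (del_edge a b G)) + 2"
proof -
  have "finite (parcs G)"
    by (rule finite_subset[of _ "pverts G \<times> pverts G"])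
      (use pair_graph_arcD[OF assms(1)] pair_graph_finite[OF assms(1)] in auto)
  moreover have "{(a, b), (b, a)} \<subseteq> parcs G" "card {(a, b), (b, a)} = 2"
    using assms pair_graph_sym pair_graph_arcD(3) by fastforce+
  ultimately show ?thesis
    using card_mono[of "parcs G" "{(a, b), (b, a)}"] by (simp add: card_Diff_subset)
qed

text \<open>The rest \<open>r\<close> of the cycle joins the two ends of \<open>e\<close> without
  using this edge in either direction.\<close>

lemma ugraph_cycle_edge_connected:
  assumes G: "pair_graph G" and C: "C \<in> ugraph_cycles G" and e: "e \<in> C"
  obtains a b where "e = {a, b}" "(a, b) \<in> parcs G" "(a, b) \<in> (parcs (del_edge a b G))\<^sup>*"
proof -
  obtain p where C_eq: "C = (\<lambda>(u, v). {u, v}) ` set p" and "3 \<le> length p"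
    and "pre_digraph.cycle (with_proj G) p"
    using C by (auto simp: ugraph_cycles_def)
  then obtain w where p: "set p \<subseteq> parcs G" "pcas w p w" "distinct (map snd p)"
    by (auto simp: cycle_iff)
  from e C_eq obtain x y where xy: "e = {x, y}" "(x, y) \<in> set p" by auto
  then obtain p1 p2 where split: "p = p1 @ (x, y) # p2" by (meson split_list)
  define r where "r = p2 @ p1"
  have r: "pcas y r x" and r_arcs: "set r \<subseteq> parcs G" and r_dist: "distinct (map snd ((x, y) # r))"
    and r_len: "2 \<le> length r"
    using p \<open>3 \<le> length p\<close> by (auto simp: split r_def pcas_append)
  \<comment> \<open>If the reverse arc occurred, distinctness of the visited vertices would leave it
    as the only arc of \<open>r\<close>. This is where cycles of length two have to be
    excluded.\<close>
  have "(y, x) \<notin> set r"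
  proof
    assume "(y, x) \<in> set r"
    then obtain r1 r2 where r_split: "r = r1 @ (y, x) # r2" by (meson split_list)
    with r have "pcas y r1 y" "pcas x r2 x" by (auto simp: pcas_append)
    then have "r1 = []" "r2 = []"
      using pcas_last[of y r1 y] pcas_last[of x r2 x] r_dist by (auto simp: r_split)
    then show False using r_len by (simp add: r_split)
  qed
  moreover have "(x, y) \<notin> set r" using r_dist by force
  ultimately have "set r \<subseteq> parcs (del_edge y x G)" using r_arcs by auto
  then have "(y, x) \<in> (parcs (del_edge y x G))\<^sup>*" by (rule pcas_imp_rtrancl[OF r])
  moreover have "(y, x) \<in> parcs G" using p(1) xy(2) pair_graph_sym[OF G] by blast
  ultimately show thesis using that[of y x] xy by blast
qed

lemma ugraph_cycles_del_edge:
  assumes C: "C \<in> ugraph_cycles G" and ab: "{a, b} \<notin> C"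
  shows "C \<in> ugraph_cycles (del_edge a b G)"
proof -
  obtain p where C_eq: "C = (\<lambda>(u, v). {u, v}) ` set p" and "3 \<le> length p"
    and "pre_digraph.cycle (with_proj G) p"
    using C by (auto simp: ugraph_cycles_def)
  moreover have "(a, b) \<notin> set p" "(b, a) \<notin> set p"
    using ab unfolding C_eq by (force simp: insert_commute)+
  ultimately show ?thesis
    by (auto simp: ugraph_cycles_def cycle_iff intro!: exI[of _ p])
qed

text \<open>The edge closes a simple path from \<open>b\<close> to \<open>a\<close> that avoids it.
  This path has at least two arcs, since \<open>a \<noteq> b\<close> and the single arc
  \<open>(b, a)\<close> has been deleted.\<close>

lemma ugraph_cycles_nonempty:
  assumes G: "pair_graph G" and ab: "(a, b) \<in> parcs G" "(a, b) \<in> (parcs (del_edge a b G))\<^sup>*"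
  shows "ugraph_cycles G \<noteq> {}"
proof -
  have "(b, a) \<in> (parcs (del_edge a b G))\<^sup>*"
    using sym_rtrancl[OF sym_parcs[OF pair_graph_del_edge[OF G]]] ab(2) by (blast dest: symD)
  from rtrancl_imp_simple_path[OF this] obtain p where p: "pcas b p a"
    "set p \<subseteq> parcs (del_edge a b G)" "distinct (b # map snd p)" by blast
  have "a \<noteq> b" using pair_graph_arcD(3)[OF G ab(1)] .
  have "2 \<le> length p"
  proof (cases p)
    case Nil
    then show ?thesis using p \<open>a \<noteq> b\<close> by simp
  next
    case (Cons e p')
    then show ?thesis using p by (cases p'; cases e) auto
  qed
  then have "pre_digraph.cycle (with_proj G) ((a, b) # p)" "3 \<le> length ((a, b) # p)"
    using p ab(1) pair_graph_arcD(1)[OF G ab(1)] by (auto simp: cycle_iff)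
  then show ?thesis unfolding ugraph_cycles_def by blast
qed

text \<open>\<open>B\<close> consists of the arcs of a breadth-first search tree and \<open>d\<close> is the distance from its root.\<close>

lemma spanning_tree_arcs:
  assumes G: "pair_graph G" and ne: "pverts G \<noteq> {}"
    and conn: "\<And>u v. u \<in> pverts G \<Longrightarrow> v \<in> pverts G \<Longrightarrow> (u, v) \<in> (parcs G)\<^sup>*"
  obtains B and d :: "'a \<Rightarrow> nat" where "B \<subseteq> parcs G" "sym B" "card B = 2 * (card (pverts G) - 1)"
    "\<And>u v. u \<in> pverts G \<Longrightarrow> v \<in> pverts G \<Longrightarrow> (u, v) \<in> B\<^sup>*"
    "\<And>u v. (u, v) \<in> B \<Longrightarrow> even (d u) \<noteq> even (d v)"
proof -
  obtain r where r: "r \<in> pverts G" using ne by blast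
  define d where "d v = (LEAST k. (r, v) \<in> parcs G ^^ k)" for v
  have d: "(r, v) \<in> parcs G ^^ d v" if "v \<in> pverts G" for v
    unfolding d_def using conn[OF r that] by (metis LeastI rtrancl_imp_relpow)
  have d_le: "d v \<le> k" if "(r, v) \<in> parcs G ^^ k" for v k
    unfolding d_def using that by (rule Least_le)
  have "\<exists>w. (w, v) \<in> parcs G \<and> d v = Suc (d w)" if v: "v \<in> pverts G - {r}" for v
  proof -
    have "d v \<noteq> 0" using d[of v] v by (intro notI) simp
    then obtain k where k: "d v = Suc k" by (cases "d v") auto
    then obtain w where w: "(r, w) \<in> parcs G ^^ k" "(w, v) \<in> parcs G"
      using d[of v] v by auto
    have "d w \<le> k" by (rule d_le[OF w(1)])
    moreover have "w \<in> pverts G" using pair_graph_arcD(1)[OF G w(2)] .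
    then have "(r, v) \<in> parcs G ^^ Suc (d w)" using d w(2) by auto
    then have "d v \<le> Suc (d w)" by (rule d_le)
    ultimately show ?thesis using k w(2) by auto
  qed
  then obtain p where p: "\<And>v. v \<in> pverts G - {r} \<Longrightarrow> (p v, v) \<in> parcs G \<and> d v = Suc (d (p v))"
    by metis
  let ?V = "pverts G - {r}"
  define B where "B = (\<lambda>v. (v, p v)) ` ?V \<union> (\<lambda>v. (p v, v)) ` ?V"
  have fin: "finite ?V" using pair_graph_finite[OF G] by simp
  \<comment> \<open>A common arc would make two vertices parents of each other, although
    \<open>d\<close> drops by one from child to parent.\<close>
  have "(\<lambda>v. (v, p v)) ` ?V \<inter> (\<lambda>v. (p v, v)) ` ?V = {}"
  proof (rule ccontr)
    assume "\<not> ?thesis"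
    then obtain v w where "v \<in> ?V" "w \<in> ?V" "v = p w" "p v = w" by auto
    then show False using p[of v] p[of w] by simp
  qed
  then have "card B = card ?V + card ?V"
    unfolding B_def using fin by (subst card_Un_disjoint) (auto simp: card_image inj_on_def)
  then have card: "card B = 2 * (card (pverts G) - 1)"
    using r pair_graph_finite[OF G] by simp
  have to_root: "(v, r) \<in> B\<^sup>*" if "v \<in> pverts G" for v
    using that
  proof (induction "d v" arbitrary: v rule: less_induct)
    case less
    show ?case
    proof (cases "v = r")
      case False
      then have v: "v \<in> ?V" using less.prems by simp
      have "(p v, r) \<in> B\<^sup>*"
        using p[OF v] pair_graph_arcD(1)[OF G] by (intro less.hyps) auto
      moreover have "(v, p v) \<in> B" using v by (auto simp: B_def)
      ultimately show ?thesis by (rule converse_rtrancl_into_rtrancl[rotated])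
    qed simp
  qed
  have "sym B" by (auto simp: B_def sym_def)
  have "(u, v) \<in> B\<^sup>*" if "u \<in> pverts G" "v \<in> pverts G" for u v
    using to_root[OF that(1)] to_root[OF that(2)] sym_rtrancl[OF \<open>sym B\<close>]
    by (meson rtrancl_trans symD)
  moreover have "B \<subseteq> parcs G"
    using p pair_graph_sym[OF G] by (auto simp: B_def)
  moreover have "even (d u) \<noteq> even (d v)" if "(u, v) \<in> B" for u v
    using that p by (auto simp: B_def)
  ultimately show thesis using card \<open>sym B\<close> that[of B d] by blast
qed

section \<open>Edge counts of connected graphs\<close>

locale connected_graph =
  fixes G :: "'a pair_pre_digraph"
  assumes G: "pair_graph G" and ne: "pverts G \<noteq> {}"
    and conn: "\<And>u v. u \<in> pverts G \<Longrightarrow> v \<in> pverts G \<Longrightarrow> (u, v) \<in> (parcs G)\<^sup>*"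
begin

lemma finite_parcs: "finite (parcs G)"
  by (rule finite_subset[of _ "pverts G \<times> pverts G"])
    (use pair_graph_arcD[OF G] pair_graph_finite[OF G] in auto)

lemma card_parcs_ge: "2 * (card (pverts G) - 1) \<le> card (parcs G)"
  using spanning_tree_arcs[OF G ne conn] card_mono[OF finite_parcs] by metis

lemma del_cycle_edge:
  assumes C: "C \<in> ugraph_cycles G" and e: "e \<in> C"
  obtains a b where "e = {a, b}" "(a, b) \<in> parcs G" "connected_graph (del_edge a b G)"
proof -
  obtain a b where ab: "e = {a, b}" "(a, b) \<in> parcs G" "(a, b) \<in> (parcs (del_edge a b G))\<^sup>*"
    using ugraph_cycle_edge_connected[OF G C e] .
  let ?D = "(parcs (del_edge a b G))\<^sup>*"
  note G' = pair_graph_del_edge[OF G, of a b]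
  have "(b, a) \<in> ?D" using ab(3) sym_rtrancl[OF sym_parcs[OF G']] by (blast dest: symD)
  then have "parcs G \<subseteq> ?D" using ab(3) by auto
  then have "(parcs G)\<^sup>* \<subseteq> ?D" by (rule rtrancl_subset_rtrancl)
  then have "connected_graph (del_edge a b G)"
    using G' ne conn by (intro connected_graph.intro) auto
  with ab that show thesis by blast
qed

text \<open>An arc outside the spanning tree would close a cycle with tree arcs, so all arcs belong
  to the tree, and the parity of the depth is a two-colouring.\<close>

lemma acyclic_card_parcs_coloring:
  assumes acyclic: "ugraph_cycles G = {}"
  shows "card (parcs G) = 2 * (card (pverts G) - 1)"
    and "\<exists>d :: 'a \<Rightarrow> nat. \<forall>u v. (u, v) \<in> parcs G \<longrightarrow> even (d u) \<noteq> even (d v)"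
proof -
  obtain B and d :: "'a \<Rightarrow> nat" where B: "B \<subseteq> parcs G" "sym B"
    "card B = 2 * (card (pverts G) - 1)"
    "\<And>u v. u \<in> pverts G \<Longrightarrow> v \<in> pverts G \<Longrightarrow> (u, v) \<in> B\<^sup>*"
    and d: "\<And>u v. (u, v) \<in> B \<Longrightarrow> even (d u) \<noteq> even (d v)"
    using spanning_tree_arcs[OF G ne conn] by metis
  have "(a, b) \<in> B" if ab: "(a, b) \<in> parcs G" for a b
  proof (rule ccontr)
    assume "(a, b) \<notin> B"
    then have "B \<subseteq> parcs (del_edge a b G)" using B(1,2) by (auto dest: symD)
    then have "B\<^sup>* \<subseteq> (parcs (del_edge a b G))\<^sup>*" by (rule rtrancl_mono)
    then have "(a, b) \<in> (parcs (del_edge a b G))\<^sup>*"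
      using B(4) pair_graph_arcD[OF G ab] by blast
    with acyclic show False using ugraph_cycles_nonempty[OF G ab] by blast
  qed
  then have "parcs G = B" using B(1) by auto
  with B(3) d show "card (parcs G) = 2 * (card (pverts G) - 1)"
    "\<exists>d :: 'a \<Rightarrow> nat. \<forall>u v. (u, v) \<in> parcs G \<longrightarrow> even (d u) \<noteq> even (d v)" by blast+
qed

text \<open>Deleting one edge of the cycle keeps the graph connected, so the remaining arcs still
  number at least those of a spanning tree. Every edge counts as two arcs.\<close>

lemma card_parcs_ge_if_cycle:
  assumes C: "C \<in> ugraph_cycles G"
  shows "2 * card (pverts G) \<le> card (parcs G)"
proof -
  have "C \<noteq> {}" using C by (auto simp: ugraph_cycles_def)
  then obtain e where "e \<in> C" by blast
  from del_cycle_edge[OF C this] obtain a b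
    where ab: "(a, b) \<in> parcs G" "connected_graph (del_edge a b G)" by metis
  have "card (pverts G) \<noteq> 0" using ne pair_graph_finite[OF G] by simp
  then show ?thesis
    using connected_graph.card_parcs_ge[OF ab(2)] card_del_edge[OF G ab(1)] by simp
qed

lemma tree_graph_iff: "tree_graph G \<longleftrightarrow> ugraph_cycles G = {}"
  using G ne conn by (auto simp: tree_graph_def connected_iff)

text \<open>If an edge of one cycle were missing from another, its deletion would leave a connected
  graph that still contains the second cycle, with too few arcs. So any two cycles contain each
  other.\<close>

lemma unicyclic_graph_if_card_parcs:
  assumes card: "card (parcs G) = 2 * card (pverts G)"
  shows "unicyclic_graph G"
proof -
  have nz: "card (pverts G) \<noteq> 0" using ne pair_graph_finite[OF G] by simp
  have "C \<subseteq> C'" if CC': "C \<in> ugraph_cycles G" "C' \<in> ugraph_cycles G" for C C'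
  proof
    fix e assume "e \<in> C"
    from del_cycle_edge[OF CC'(1) this] obtain a b
      where ab: "e = {a, b}" "(a, b) \<in> parcs G" "connected_graph (del_edge a b G)" .
    show "e \<in> C'"
    proof (rule ccontr)
      assume "e \<notin> C'"
      then have "C' \<in> ugraph_cycles (del_edge a b G)"
        using ugraph_cycles_del_edge[OF CC'(2)] ab(1) by blast
      from connected_graph.card_parcs_ge_if_cycle[OF ab(3) this] show False
        using card_del_edge[OF G ab(2)] card by simp
    qed
  qed
  moreover have "ugraph_cycles G \<noteq> {}"
    using acyclic_card_parcs_coloring(1) card nz by auto
  ultimately have "\<exists>!C. C \<in> ugraph_cycles G" by (metis all_not_in_conv subset_antisym)
  then show ?thesis using G ne conn by (auto simp: unicyclic_graph_def connected_iff)
qed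

lemma bipartite_graph_if_no_odd_closed_walk:
  assumes odd: "\<And>u k. odd k \<Longrightarrow> (u, u) \<notin> parcs G ^^ k"
  shows "bipartite_graph G"
proof -
  obtain r where r: "r \<in> pverts G" using ne by blast
  have sym: "(v, u) \<in> parcs G ^^ k" if "(u, v) \<in> parcs G ^^ k" for u v k
    using that
  proof (induction k arbitrary: v)
    case (Suc k)
    then obtain w where "(u, w) \<in> parcs G ^^ k" "(w, v) \<in> parcs G" by auto
    then show ?case using Suc.IH pair_graph_sym[OF G] by (intro relpow_Suc_I2[of v w]) auto
  qed simp
  define X where "X = {v \<in> pverts G. \<exists>k. even k \<and> (r, v) \<in> parcs G ^^ k}"
  have parity: "(u \<in> X) \<noteq> (v \<in> X)" if uv: "(u, v) \<in> parcs G" for u v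
  proof -
    have verts: "u \<in> pverts G" "v \<in> pverts G" using pair_graph_arcD[OF G uv] by auto
    obtain k where k: "(r, u) \<in> parcs G ^^ k"
      using conn[OF r verts(1)] by (metis rtrancl_imp_relpow)
    then have k': "(r, v) \<in> parcs G ^^ Suc k" using uv by auto
    \<comment> \<open>Going to \<open>w\<close> along one walk and back along the other is a closed
      walk of length \<open>i + j\<close>.\<close>
    have same: "even i \<longleftrightarrow> even j" if "(r, w) \<in> parcs G ^^ i" "(r, w) \<in> parcs G ^^ j" for i j w
    proof -
      have "(r, r) \<in> parcs G ^^ (i + j)"
        unfolding relpow_add using that(1) sym[OF that(2)] by blast
      with odd show ?thesis by (metis even_add)
    qed
    have "u \<in> X \<longleftrightarrow> even k"
      unfolding X_def using verts(1) k same[OF k] by blast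
    moreover have "v \<in> X \<longleftrightarrow> even (Suc k)"
      unfolding X_def using verts(2) k' same[OF k'] by blast
    ultimately show ?thesis by simp
  qed
  have "pverts G = X \<union> (pverts G - X)" "X \<inter> (pverts G - X) = {}"
    by (auto simp: X_def)
  moreover have "parcs G \<subseteq> X \<times> (pverts G - X) \<union> (pverts G - X) \<times> X"
    using parity pair_graph_arcD[OF G] by auto
  ultimately show ?thesis unfolding bipartite_graph_def using G by blast
qed

end

lemma tree_graph_imp_connected: "tree_graph G \<Longrightarrow> connected_graph G"
  and unicyclic_graph_imp_connected: "unicyclic_graph G \<Longrightarrow> connected_graph G"
  by (auto simp: tree_graph_def unicyclic_graph_def connected_iff intro: connected_graph.intro)

lemma coloring_imp_no_odd_closed_walk:
  fixes d :: "'a \<Rightarrow> nat"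
  assumes d: "\<And>u v. (u, v) \<in> A \<Longrightarrow> even (d u) \<noteq> even (d v)" and "odd k"
  shows "(u, u) \<notin> A ^^ k"
proof -
  have "(even (d u) \<longleftrightarrow> even (d v)) \<longleftrightarrow> even k" if "(u, v) \<in> A ^^ k" for v k
    using that
  proof (induction k arbitrary: v)
    case (Suc k)
    then obtain w where "(u, w) \<in> A ^^ k" "(w, v) \<in> A" by auto
    with Suc.IH d show ?case by auto
  qed simp
  with \<open>odd k\<close> show ?thesis by blast
qed

section \<open>Irreducible factors of the main polynomial\<close>

text \<open>Otherwise the two polynomials are coprime over the rationals, and a Bezout relation
  evaluated at \<open>l\<close> reads \<open>0 = 1\<close>.\<close>

lemma irreducible_common_root_dvd:
  fixes f p :: "rat poly"
  assumes f: "irreducible f" and root: "poly (map_poly real_of_rat f) l = 0"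
    "poly (map_poly real_of_rat p) l = 0"
  shows "f dvd p"
proof (rule ccontr)
  assume "\<not> f dvd p"
  then have "Rings.coprime f p"
    using f by (intro prime_elem_imp_coprime) (auto simp: prime_elem_iff_irreducible)
  then obtain u v where "u * f + v * p = 1"
    using bezout_coefficients_fst_snd[of f p] by (auto simp: coprime_iff_gcd_eq_1)
  from arg_cong[OF this, of "\<lambda>r. poly (map_poly real_of_rat r) l"] root show False
    by (simp add: hom_distribs)
qed

lemma ex_monic_irreducible_dvd:
  fixes p :: "'a :: field_gcd poly"
  assumes "p \<noteq> 0" "\<not> is_unit p"
  obtains f where "monic f" "irreducible f" "f dvd p"
proof -
  obtain b where b: "b dvd p" "prime b" using prime_divisor_exists[OF assms] by blast
  then have irr: "irreducible b" by (intro prime_elem_imp_irreducible prime_imp_prime_elem)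
  then have nz: "lead_coeff b \<noteq> 0" by auto
  show thesis
  proof (rule that[of "smult (inverse (lead_coeff b)) b"])
    show "irreducible (smult (inverse (lead_coeff b)) b)"
      unfolding irreducible_smult using irr nz by simp
    show "smult (inverse (lead_coeff b)) b dvd p"
      using b(1) nz by (intro smult_dvd) auto
    show "monic (smult (inverse (lead_coeff b)) b)" using nz by simp
  qed
qed

lemma ex_irreducible_factor_with_root:
  fixes p :: "rat poly"
  assumes "p \<noteq> 0" "poly (map_poly real_of_rat p) l = 0"
  shows "\<exists>f. monic f \<and> irreducible f \<and> f dvd p \<and> poly (map_poly real_of_rat f) l = 0"
  using assms
proof (induction "degree p" arbitrary: p rule: less_induct)
  case less
  have "\<not> is_unit p"
  proof
    assume "is_unit p"
    then have "degree p = 0" by simp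
    then obtain c where "p = [:c:]" by (rule degree_eq_zeroE)
    with less.prems show False by simp
  qed
  then obtain b where b: "monic b" "irreducible b" "b dvd p"
    using ex_monic_irreducible_dvd less.prems(1) by blast
  then obtain r where r: "p = b * r" by (auto elim: dvdE)
  show ?case
  proof (cases "poly (map_poly real_of_rat b) l = 0")
    case False
    then have root: "poly (map_poly real_of_rat r) l = 0"
      using less.prems(2) by (simp add: r hom_distribs)
    have "degree b \<noteq> 0" using b(1,2) monic_degree_0 by fastforce
    then have "degree r < degree p"
      using less.prems(1) by (auto simp: r degree_mult_eq)
    then obtain f where "monic f" "irreducible f" "f dvd r" "poly (map_poly real_of_rat f) l = 0"
      using less.hyps[of r] less.prems(1) root r by auto
    then show ?thesis unfolding r by auto
  qed (use b in blast)
qed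

text \<open>Gauss's lemma: the primitive integral multiple \<open>g\<close> of \<open>f\<close>
  divides \<open>p\<close> over the integers. As \<open>p\<close> is monic, the leading coefficient
  of \<open>g\<close> is \<open>1\<close> or \<open>-1\<close>, and \<open>g\<close> differs from
  \<open>f\<close> at most by this sign.\<close>

lemma monic_rat_factor_of_int_poly:
  fixes p :: "int poly" and f :: "rat poly"
  assumes p: "monic p" and f: "monic f" "f dvd map_poly rat_of_int p"
  obtains g where "monic g" "map_poly rat_of_int g = f"
proof -
  obtain h where h: "map_poly rat_of_int p = f * h" using f(2) by (auto elim: dvdE)
  obtain r g where rg: "rat_to_normalized_int_poly f = (r, g)" by force
  have fg: "f = smult r (map_poly rat_of_int g)"
    using rat_to_normalized_int_poly[OF rg] by simp
  obtain c where "p = g * smult (content p) c"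
    using rat_to_int_factor_explicit[OF h rg] by blast
  then have "lead_coeff g dvd 1"
    using p by (metis dvd_triv_left lead_coeff_mult)
  then have lc: "lead_coeff g * lead_coeff g = 1" by (auto simp: zdvd1_eq abs_if split: if_splits)
  have "r * of_int (lead_coeff g) = 1"
    using f(1) unfolding fg by (cases "r = 0") auto
  then have r: "r = of_int (lead_coeff g)"
    using lc by (metis mult.assoc mult.right_neutral mult_1 of_int_1 of_int_mult)
  show thesis
  proof (rule that[of "smult (lead_coeff g) g"])
    show "monic (smult (lead_coeff g) g)" using lc by (cases "g = 0") auto
    show "map_poly rat_of_int (smult (lead_coeff g) g) = f"
      unfolding fg r by (simp add: hom_distribs)
  qed
qed

text \<open>Main polynomials have only simple roots and split over the reals, so a monic divisor is
  determined by its set of roots.\<close>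

lemma monic_dvd_main_poly_eqI:
  assumes H: "pair_graph H" and R: "pair_graph R"
    and p: "monic p" "p dvd main_poly H" and roots: "\<And>l. poly p l = 0 \<longleftrightarrow> main_eigenvalue R l"
  shows "p = main_poly R"
proof -
  have "p dvd (\<Prod>l | main_eigenvalue H l. [:- l, 1:])"
    using p(2) by (simp only: main_poly_def)
  from monic_dvd_prod_linear[OF finite_main_eigenvalues[OF H] p(1), of "\<lambda>l. l", OF this]
  obtain I where I: "I \<subseteq> {l. main_eigenvalue H l}" "p = (\<Prod>l\<in>I. [:- l, 1:])"
    by auto
  have "finite I" using I(1) finite_main_eigenvalues[OF H] by (rule finite_subset)
  then have "poly p l = 0 \<longleftrightarrow> l \<in> I" for l unfolding I(2) by (auto simp: poly_prod)
  then have "I = {l. main_eigenvalue R l}" using roots by blast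
  then show ?thesis by (simp add: I(2) main_poly_def)
qed

lemma square_dvd_imp_order_ge_2:
  fixes p q :: "real poly"
  assumes "p ^ 2 dvd q" "q \<noteq> 0" "poly p l = 0"
  shows "2 \<le> order l q"
proof -
  have "[:- l, 1:] dvd p" using assms(3) by (simp add: poly_eq_0_iff_dvd)
  then have "[:- l, 1:] ^ 2 dvd q" using assms(1) dvd_power_same dvd_trans by blast
  then show ?thesis using assms(2) by (simp only: order_divides simp_thms)
qed

lemma main_factors:
  assumes T: "connected_graph T" and mult: "main_factor_mult T = 2"
  obtains f g :: "rat poly" where "f \<noteq> g" "monic f" "monic g" "irreducible f" "irreducible g"
    "main_rat T = f * g" "multiplicity f (graph_poly T) = 1" "multiplicity g (graph_poly T) = 1"
proof -
  interpret connected_graph T by fact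
  let ?h = "map_poly real_of_rat"
  define F where "F = {f. monic f \<and> irreducible f \<and> f dvd graph_poly T \<and> ?h f dvd main_poly T}"
  \<comment> \<open>Divisibility between rational polynomials descends from the reals, so
    \<open>F\<close> consists of the monic irreducible factors of \<open>main_rat T\<close>.\<close>
  have F_iff: "f \<in> F \<longleftrightarrow> monic f \<and> irreducible f \<and> f dvd main_rat T" for f
    unfolding F_def map_main_rat[OF G, symmetric]
    using of_rat_hom.dvd_map_poly_hom_imp_dvd real_of_rat_poly.hom_dvd dvd_trans[OF _ main_rat_dvd]
    by blast
  let ?m = "\<lambda>f. multiplicity f (graph_poly T)"
  have sum: "(\<Sum>f\<in>F. ?m f) = 2" using mult by (simp add: main_factor_mult_def F_def)
  \<comment> \<open>A sum over an infinite set is \<open>0\<close> by convention, which contradicts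
    the value two.\<close>
  have fin: "finite F"
  proof (rule ccontr)
    assume "infinite F"
    with sum show False by simp
  qed
  have phi: "graph_poly T \<noteq> 0" by (rule graph_char_poly_nonzero)
  have pos: "0 < ?m f" if "f \<in> F" for f
    using that phi by (auto simp: F_def multiplicity_gt_zero_iff)
  have M: "main_rat T \<noteq> 0" using monic_main_rat[of T] by auto
  have single: "?m f = 1" if f: "f \<in> F" for f
  proof (rule ccontr)
    assume "?m f \<noteq> 1"
    then have "2 \<le> ?m f" using pos[OF f] by simp
    moreover have "?m f + (\<Sum>g\<in>F - {f}. ?m g) = 2"
      using sum.remove[OF fin f, of ?m] sum by simp
    ultimately have "(\<Sum>g\<in>F - {f}. ?m g) = 0" by simp
    then have zero: "\<forall>g\<in>F - {f}. ?m g = 0" using fin by simp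
    have only: "g = f" if "g \<in> F" for g
      using pos[OF that] that zero by (cases "g = f") auto
    obtain l where l: "main_eigenvalue T l" "order l (char_poly (adj_matrix T)) = 1"
      using perron_main_eigenvalue[OF G ne conn] .
    have "poly (?h (main_rat T)) l = 0"
      using l(1) by (simp add: map_main_rat[OF G] poly_main_poly_eq_0_iff[OF G])
    then obtain g where "g \<in> F" "poly (?h g) l = 0"
      using ex_irreducible_factor_with_root[OF M] F_iff by blast
    then have root: "poly (?h f) l = 0" using only by blast
    have "f ^ 2 dvd graph_poly T"
      using \<open>2 \<le> ?m f\<close> by (rule multiplicity_dvd')
    then have "?h f ^ 2 dvd char_poly (adj_matrix T)"
      using real_of_rat_poly.hom_dvd[of "f ^ 2"]
      by (metis of_rat_hom.map_graph_char_poly real_of_rat_poly.hom_power)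
    then have "2 \<le> order l (char_poly (adj_matrix T))"
      using graph_char_poly_nonzero root by (rule square_dvd_imp_order_ge_2)
    with l(2) show False by simp
  qed
  then have "card F = 2" using sum by simp
  then obtain f g where F: "F = {f, g}" "f \<noteq> g" by (auto simp: card_2_iff)
  then have f: "monic f" "irreducible f" "f dvd main_rat T"
    and g: "monic g" "irreducible g" "g dvd main_rat T" using F_iff by auto
  have "Rings.coprime f g"
  proof (rule prime_elem_imp_coprime)
    show "prime_elem f" using f by (simp add: prime_elem_iff_irreducible)
    show "\<not> f dvd g"
    proof
      assume "f dvd g"
      then obtain r where r: "g = f * r" by (rule dvdE)
      then have "is_unit r" using irreducibleD[OF g(2) r] f(2) by (auto simp: irreducible_def)
      moreover have "monic r" using g(1) f(1) monic_factor[of f r] r by simp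
      ultimately have "r = 1" by (metis is_unit_poly_iff lead_coeff_pCons(2) one_pCons)
      with r \<open>f \<noteq> g\<close> show False by simp
    qed
  qed
  then have "f * g dvd main_rat T" using f g by (simp add: divides_mult)
  then obtain r where r: "main_rat T = f * g * r" by (rule dvdE)
  \<comment> \<open>A further irreducible factor would again be \<open>f\<close> or
    \<open>g\<close>, and its square would divide the characteristic polynomial.\<close>
  have "is_unit r"
  proof (rule ccontr)
    assume "\<not> is_unit r"
    moreover have "r \<noteq> 0" using M r by auto
    ultimately obtain h where h: "monic h" "irreducible h" "h dvd r"
      using ex_monic_irreducible_dvd by blast
    then have "h \<in> F" unfolding F_iff r by auto
    then have "h ^ 2 dvd main_rat T"
      using h(3) F(1) unfolding r power2_eq_square by (auto simp: mult.commute intro: mult_dvd_mono)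
    then have "h ^ 2 dvd graph_poly T" using main_rat_dvd dvd_trans by blast
    then have "2 \<le> ?m h" using phi h(2) by (intro multiplicity_geI) auto
    with single[OF \<open>h \<in> F\<close>] show False by simp
  qed
  moreover have "monic r"
    using monic_main_rat[of T] f(1) g(1) monic_factor[of "f * g" r] monic_mult[of f g]
    by (simp add: r)
  ultimately have "r = 1" by (metis is_unit_poly_iff lead_coeff_pCons(2) one_pCons)
  then show thesis using that[of f g] F f g r single by simp
qed

section \<open>Unions of components\<close>

text \<open>Unions of several components are covered, so that the remainder of a graph can be
  handled as one piece before its components are known.\<close>

definition component_union :: "'a pair_pre_digraph \<Rightarrow> 'a pair_pre_digraph \<Rightarrow> bool" where
  "component_union R H \<longleftrightarrow> pair_graph R \<and> pverts R \<subseteq> pverts H \<and>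
     (\<forall>u\<in>pverts R. \<forall>v. (u, v) \<in> parcs R \<longleftrightarrow> (u, v) \<in> parcs H)"

definition restrict_graph :: "'a pair_pre_digraph \<Rightarrow> 'a set \<Rightarrow> 'a pair_pre_digraph" where
  "restrict_graph H X = \<lparr>pverts = X, parcs = parcs H \<inter> X \<times> X\<rparr>"

lemma restrict_graph_simps [simp]:
  "pverts (restrict_graph H X) = X" "parcs (restrict_graph H X) = parcs H \<inter> X \<times> X"
  by (simp_all add: restrict_graph_def)

lemma component_union_restrict_graph:
  assumes H: "pair_graph H" and X: "X \<subseteq> pverts H"
    and closed: "\<And>u v. u \<in> X \<Longrightarrow> (u, v) \<in> parcs H \<Longrightarrow> v \<in> X"
  shows "component_union (restrict_graph H X) H"
proof -
  have "pair_graph (restrict_graph H X)"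
    using finite_subset[OF X pair_graph_finite[OF H]] pair_graph_sym[OF H] pair_graph_arcD(3)[OF H]
    by (intro pair_graphI) auto
  with X closed show ?thesis by (auto simp: component_union_def)
qed

lemma is_disjoint_union_component_union:
  assumes "is_disjoint_union H R U" "pair_graph R" "pair_graph U"
  shows "component_union R H" "component_union U H"
  using assms pair_graph_arcD(1)[of R] pair_graph_arcD(1)[of U]
  by (auto simp: is_disjoint_union_def component_union_def; blast)+

lemma component_union_sum:
  assumes H: "pair_graph H" and R: "component_union R H" and u: "u \<in> pverts R"
  shows "(\<Sum>v\<in>pverts H. adj H u v * x v) = (\<Sum>v\<in>pverts R. adj R u v * x v)"
proof -
  have eq: "adj H u v = adj R u v" for v
    using R u by (simp add: component_union_def adj_def)
  have "adj R u v = 0" if "v \<notin> pverts R" for v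
    using R that pair_graph_arcD(2)[of R u v] by (auto simp: component_union_def adj_def)
  then show ?thesis
    using R pair_graph_finite[OF H] unfolding eq
    by (intro sum.mono_neutral_right) (auto simp: component_union_def)
qed

text \<open>A vertex outside \<open>R\<close> has no neighbour in \<open>R\<close>, so the extension
  by zero satisfies the eigenvector equation there as well.\<close>

lemma component_union_extend_eigenvector:
  assumes H: "pair_graph H" and R: "component_union R H"
    and x: "\<And>u. u \<in> pverts R \<Longrightarrow> (\<Sum>v\<in>pverts R. adj R u v * x v) = l * x u"
  defines "y \<equiv> \<lambda>v. if v \<in> pverts R then x v else 0"
  assumes u: "u \<in> pverts H"
  shows "(\<Sum>v\<in>pverts H. adj H u v * y v) = l * y u"
proof (cases "u \<in> pverts R")
  case True
  have "(\<Sum>v\<in>pverts R. adj R u v * y v) = (\<Sum>v\<in>pverts R. adj R u v * x v)"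
    by (intro sum.cong) (auto simp: y_def)
  with True show ?thesis
    unfolding component_union_sum[OF H R True] by (simp add: x y_def)
next
  case False
  have "adj H u v * y v = 0" for v
  proof (cases "v \<in> pverts R \<and> (u, v) \<in> parcs H")
    case True
    then have "(v, u) \<in> parcs R"
      using R pair_graph_sym[OF H] by (auto simp: component_union_def)
    then have "u \<in> pverts R" using R pair_graph_arcD(2) by (auto simp: component_union_def)
    with False show ?thesis by simp
  qed (auto simp: y_def adj_def)
  then have "(\<Sum>v\<in>pverts H. adj H u v * y v) = 0" by (simp only: sum.neutral_const)
  moreover have "y u = 0" using False by (simp add: y_def)
  ultimately show ?thesis by simp
qed

lemma component_union_main_eigenvalue:
  assumes H: "pair_graph H" and R: "component_union R H" and l: "main_eigenvalue R l"
  shows "main_eigenvalue H l"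
proof -
  have R': "pair_graph R" "pverts R \<subseteq> pverts H" using R by (auto simp: component_union_def)
  obtain x where x: "\<And>u. u \<in> pverts R \<Longrightarrow> (\<Sum>v\<in>pverts R. adj R u v * x v) = l * x u"
    and sum: "(\<Sum>u\<in>pverts R. x u) \<noteq> 0"
    using l unfolding main_eigenvalue_iff[OF R'(1)] by auto
  let ?y = "\<lambda>v. if v \<in> pverts R then x v else 0"
  have "(\<Sum>v\<in>pverts H. ?y v) = (\<Sum>v\<in>pverts R. x v)"
    using R' pair_graph_finite[OF H] by (intro sum.mono_neutral_cong_right) auto
  then show ?thesis
    unfolding main_eigenvalue_iff[OF H]
    using component_union_extend_eigenvector[OF H R x] sum by (intro exI[of _ ?y]) simp
qed

text \<open>The extensions by zero from disjoint vertex sets are orthogonal eigenvectors for the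
  same eigenvalue.\<close>

lemma component_union_common_main_eigenvalue:
  assumes H: "pair_graph H" and R: "component_union R H" and U: "component_union U H"
    and disj: "pverts R \<inter> pverts U = {}"
    and l: "main_eigenvalue R l" "main_eigenvalue U l"
  shows "2 \<le> order l (char_poly (adj_matrix H))"
proof -
  obtain q lam where "graph_eigenbasis H q lam" using ex_graph_eigenbasis[OF H] .
  then interpret graph_eigenbasis H q lam .
  have RU: "pair_graph R" "pair_graph U" "pverts R \<subseteq> pverts H" "pverts U \<subseteq> pverts H"
    using R U by (auto simp: component_union_def)
  obtain x where x: "\<And>u. u \<in> pverts R \<Longrightarrow> (\<Sum>v\<in>pverts R. adj R u v * x v) = l * x u"
    and sum_x: "(\<Sum>u\<in>pverts R. x u) \<noteq> 0"
    using l(1) unfolding main_eigenvalue_iff[OF RU(1)] by auto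
  obtain y where y: "\<And>u. u \<in> pverts U \<Longrightarrow> (\<Sum>v\<in>pverts U. adj U u v * y v) = l * y u"
    and sum_y: "(\<Sum>u\<in>pverts U. y u) \<noteq> 0"
    using l(2) unfolding main_eigenvalue_iff[OF RU(2)] by auto
  obtain u where u: "u \<in> pverts R" "x u \<noteq> 0"
    using sum_x by (rule sum.not_neutral_contains_not_neutral)
  obtain w where w: "w \<in> pverts U" "y w \<noteq> 0"
    using sum_y by (rule sum.not_neutral_contains_not_neutral)
  show ?thesis
  proof (rule order_char_poly_ge_2)
    show "(\<Sum>v\<in>pverts H. adj H z v * (if v \<in> pverts R then x v else 0)) =
        l * (if z \<in> pverts R then x z else 0)" if "z \<in> pverts H" for z
      using component_union_extend_eigenvector[OF H R x that] .
    show "(\<Sum>v\<in>pverts H. adj H z v * (if v \<in> pverts U then y v else 0)) =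
        l * (if z \<in> pverts U then y z else 0)" if "z \<in> pverts H" for z
      using component_union_extend_eigenvector[OF H U y that] .
    show "u \<in> pverts H" "w \<in> pverts H" using u w RU by auto
    show "(if u \<in> pverts R then x u else 0) \<noteq> 0" "(if w \<in> pverts U then y w else 0) \<noteq> 0"
      using u w by auto
    show "(\<Sum>v\<in>pverts H. (if v \<in> pverts R then x v else 0) * (if v \<in> pverts U then y v else 0)) = 0"
      using disj by (intro sum.neutral) auto
  qed
qed

text \<open>The first conjunct excludes polynomials without real roots, for which the second holds
  vacuously; two graphs that share a factor then share a main eigenvalue.\<close>

definition has_factor :: "'a pair_pre_digraph \<Rightarrow> rat poly \<Rightarrow> bool" where
  "has_factor R p \<longleftrightarrow> (\<exists>l. poly (map_poly real_of_rat p) l = 0) \<and>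
     (\<forall>l. poly (map_poly real_of_rat p) l = 0 \<longrightarrow> main_eigenvalue R l)"

text \<open>These are the facts that a generalized cospectral mate inherits from the tree. They are
  symmetric in \<open>f\<close> and \<open>g\<close>, so results about \<open>f\<close> carry over
  by \<open>swap\<close>.\<close>

locale two_main_factors =
  fixes H :: "'a pair_pre_digraph" and f g :: "rat poly"
  assumes H: "pair_graph H" and fg: "monic f" "monic g" "irreducible f" "irreducible g"
    and main_poly: "main_poly H = map_poly real_of_rat (f * g)"
    and mult: "multiplicity f (graph_poly H) = 1" "multiplicity g (graph_poly H) = 1"
begin

lemma swap: "two_main_factors H g f"
  using H fg main_poly mult by (simp add: two_main_factors_def mult.commute)

lemma main_eigenvalue_iff_root:
  "main_eigenvalue H l \<longleftrightarrow>
    poly (map_poly real_of_rat f) l = 0 \<or> poly (map_poly real_of_rat g) l = 0"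
  using poly_main_poly_eq_0_iff[OF H, of l] by (simp add: main_poly hom_distribs)

text \<open>The cofactor of \<open>f\<close> in the characteristic polynomial is not divisible by
  \<open>f\<close> and hence does not vanish at \<open>l\<close>; and \<open>l\<close> is a simple
  root of \<open>f\<close>, which divides the squarefree main polynomial.\<close>

lemma order_char_poly_root:
  assumes "poly (map_poly real_of_rat f) l = 0"
  shows "order l (char_poly (adj_matrix H)) = 1"
proof -
  let ?h = "map_poly real_of_rat"
  obtain q lam where "graph_eigenbasis H q lam" using ex_graph_eigenbasis[OF H] .
  then interpret graph_eigenbasis H q lam .
  have phi: "graph_poly H \<noteq> 0" by (rule graph_char_poly_nonzero)
  have "f dvd graph_poly H" using mult(1) by (metis not_dvd_imp_multiplicity_0 zero_neq_one)
  then obtain r where r: "graph_poly H = f * r" by (rule dvdE)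
  have "\<not> f dvd r"
  proof
    assume "f dvd r"
    then have "f ^ 2 dvd graph_poly H" unfolding r power2_eq_square by (rule mult_dvd_mono[OF dvd_refl])
    then have "2 \<le> multiplicity f (graph_poly H)"
      using phi fg(3) by (intro multiplicity_geI) auto
    with mult(1) show False by simp
  qed
  then have "poly (?h r) l \<noteq> 0" using irreducible_common_root_dvd[OF fg(3) assms] by blast
  moreover have "r \<noteq> 0" "f \<noteq> 0" using phi r by auto
  moreover have "char_poly (adj_matrix H) = ?h f * ?h r"
    unfolding of_rat_hom.map_graph_char_poly[symmetric, where ?'a = real]
    by (simp add: r hom_distribs)
  ultimately have "order l (char_poly (adj_matrix H)) = order l (?h f)"
    by (simp add: order_mult order_0I)
  moreover have "order l (?h f) \<le> order l (?h (main_rat H))"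
    unfolding map_main_rat[OF H] main_poly using \<open>f \<noteq> 0\<close> fg(2)
    by (intro dvd_imp_order_le) (auto simp: hom_distribs)
  moreover have "order l (?h f) \<noteq> 0" using assms \<open>f \<noteq> 0\<close> by (simp add: order_root)
  ultimately show ?thesis using order_main_rat[of l] by (simp split: if_splits)
qed

lemma order_main_eigenvalue:
  "main_eigenvalue H l \<Longrightarrow> order l (char_poly (adj_matrix H)) = 1"
  using order_char_poly_root two_main_factors.order_char_poly_root[OF swap] main_eigenvalue_iff_root by blast

lemma disjoint_no_common_main_eigenvalue:
  assumes "component_union R H" "component_union U H" "pverts R \<inter> pverts U = {}"
    and "main_eigenvalue R l" "main_eigenvalue U l"
  shows False
  using component_union_common_main_eigenvalue[OF H assms]
    order_main_eigenvalue[OF component_union_main_eigenvalue[OF H assms(1,4)]] by simp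

text \<open>The main polynomial of \<open>R\<close> itself is rational, so one main eigenvalue
  brings with it all roots of the irreducible polynomial to which it belongs.\<close>

lemma has_factor_cases:
  assumes R: "component_union R H" and ne: "pverts R \<noteq> {}"
  shows "has_factor R f \<or> has_factor R g"
proof -
  let ?h = "map_poly real_of_rat"
  have R': "pair_graph R" using R by (simp add: component_union_def)
  obtain l where l: "main_eigenvalue R l" using ex_main_eigenvalue[OF R' ne] by blast
  have root: "poly (?h (main_rat R)) l = 0"
    using l by (simp add: map_main_rat[OF R'] poly_main_poly_eq_0_iff[OF R'])
  have "has_factor R p" if p: "irreducible p" "poly (?h p) l = 0" for p
  proof -
    have "p dvd main_rat R" using irreducible_common_root_dvd[OF p root] .
    then have "?h p dvd main_poly R"
      unfolding map_main_rat[OF R', symmetric] by (rule real_of_rat_poly.hom_dvd)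
    then have "main_eigenvalue R k" if "poly (?h p) k = 0" for k
      using that unfolding poly_main_poly_eq_0_iff[OF R', symmetric] by (auto elim: dvdE)
    with p show ?thesis by (auto simp: has_factor_def)
  qed
  then show ?thesis
    using component_union_main_eigenvalue[OF H R l] main_eigenvalue_iff_root fg by blast
qed

lemma not_both_has_factor:
  assumes "component_union R H" "component_union U H" "pverts R \<inter> pverts U = {}"
    and "has_factor R p" "has_factor U p"
  shows False
  using assms disjoint_no_common_main_eigenvalue[OF assms(1-3)] unfolding has_factor_def by blast

text \<open>A main eigenvalue of \<open>R\<close> is a root of \<open>f\<close> or of
  \<open>g\<close>; the roots of \<open>g\<close> are already main in \<open>U\<close> and cannot be
  shared.\<close>

lemma main_poly_eq_if_has_factor:
  assumes R: "component_union R H" and U: "component_union U H"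
    and disj: "pverts R \<inter> pverts U = {}" and has: "has_factor R f" "has_factor U g"
  shows "main_poly R = map_poly real_of_rat f"
proof (rule monic_dvd_main_poly_eqI[OF H, symmetric])
  show "pair_graph R" using R by (simp add: component_union_def)
  show "monic (map_poly real_of_rat f)" using fg(1) by simp
  show "map_poly real_of_rat f dvd main_poly H" by (simp add: main_poly hom_distribs)
  show "poly (map_poly real_of_rat f) l = 0 \<longleftrightarrow> main_eigenvalue R l" for l
    using has disjoint_no_common_main_eigenvalue[OF R U disj, of l] main_eigenvalue_iff_root
      component_union_main_eigenvalue[OF H R] unfolding has_factor_def by blast
qed

lemma main_poly_disjoint_union:
  assumes R: "component_union R H" "pverts R \<noteq> {}" and U: "component_union U H" "pverts U \<noteq> {}"
    and disj: "pverts R \<inter> pverts U = {}"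
  shows "(main_poly R = map_poly real_of_rat f \<and> main_poly U = map_poly real_of_rat g) \<or>
    (main_poly R = map_poly real_of_rat g \<and> main_poly U = map_poly real_of_rat f)"
proof -
  interpret sw: two_main_factors H g f by (rule swap)
  have disj': "pverts U \<inter> pverts R = {}" using disj by blast
  consider "has_factor R f" "has_factor U g" | "has_factor R g" "has_factor U f"
    using has_factor_cases[OF R] has_factor_cases[OF U] not_both_has_factor[OF R(1) U(1) disj]
    by blast
  then show ?thesis
  proof cases
    case 1
    then show ?thesis
      using main_poly_eq_if_has_factor[OF R(1) U(1) disj] sw.main_poly_eq_if_has_factor[OF U(1) R(1) disj']
      by blast
  next
    case 2
    then show ?thesis
      using main_poly_eq_if_has_factor[OF U(1) R(1) disj'] sw.main_poly_eq_if_has_factor[OF R(1) U(1) disj]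
      by blast
  qed
qed

text \<open>Pigeonhole: each of the three pieces would own one of only two factors.\<close>

lemma no_three_components:
  assumes "component_union R H" "component_union U H" "component_union W H"
    and "pverts R \<noteq> {}" "pverts U \<noteq> {}" "pverts W \<noteq> {}"
    and "pverts R \<inter> pverts U = {}" "pverts R \<inter> pverts W = {}" "pverts U \<inter> pverts W = {}"
  shows False
  using has_factor_cases[OF assms(1,4)] has_factor_cases[OF assms(2,5)] has_factor_cases[OF assms(3,6)]
    not_both_has_factor[OF assms(1,2,7)] not_both_has_factor[OF assms(1,3,8)]
    not_both_has_factor[OF assms(2,3,9)] by blast

end

section \<open>Generalized cospectral mates of trees\<close>

lemma trace_cong:
  assumes G: "pair_graph G" and H: "pair_graph H" and eq: "adj_spectrum G = adj_spectrum H"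
  shows "(\<Sum>u\<in>pverts G. walk_count G k u u) = (\<Sum>u\<in>pverts H. walk_count H k u u)"
proof -
  obtain q lam where 1: "graph_eigenbasis G q lam" using ex_graph_eigenbasis[OF G] .
  obtain r mu where 2: "graph_eigenbasis H r mu" using ex_graph_eigenbasis[OF H] .
  show ?thesis
    unfolding graph_eigenbasis.trace_eq[OF 1] graph_eigenbasis.trace_eq[OF 2] eq ..
qed

lemma card_parcs_cong:
  assumes "pair_graph G" "pair_graph H" "adj_spectrum G = adj_spectrum H"
  shows "card (parcs G) = card (parcs H)"
  using trace_cong[OF assms, of 2] trace_2[OF assms(1)] trace_2[OF assms(2)] by simp

text \<open>The spectrum determines the number of closed walks of length \<open>k\<close>, which is
  a sum of nonnegative terms.\<close>

lemma no_odd_closed_walk_cong: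
  assumes G: "pair_graph G" and H: "pair_graph H" and eq: "adj_spectrum G = adj_spectrum H"
    and G_odd: "\<And>u. (u, u) \<notin> parcs G ^^ k" and "odd k"
  shows "(u, u) \<notin> parcs H ^^ k"
proof
  assume uu: "(u, u) \<in> parcs H ^^ k"
  \<comment> \<open>For positive \<open>k\<close> the element \<open>u\<close> is an end of an arc
    and thus a vertex; the zeroth power of the relation also contains pairs outside the
    graph.\<close>
  obtain j where "k = Suc j" using \<open>odd k\<close> by (cases k) auto
  with uu have "u \<in> pverts H" using pair_graph_arcD(2)[OF H] by auto
  moreover have "(\<Sum>u\<in>pverts H. walk_count H k u u) = 0"
    unfolding trace_cong[OF G H eq, symmetric]
    using G_odd walk_count_eq_0_iff[OF G] by (intro sum.neutral) blast
  then have "\<forall>u\<in>pverts H. walk_count H k u u = 0"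
    using pair_graph_finite[OF H] by (simp add: sum_nonneg_eq_0_iff walk_count_nonneg)
  ultimately show False using uu walk_count_eq_0_iff[OF H] by blast
qed

lemma connected_graph_restrict_graph:
  assumes H: "pair_graph H" and X: "X \<subseteq> pverts H" "X \<noteq> {}"
    and closed: "\<And>u v. u \<in> X \<Longrightarrow> (u, v) \<in> parcs H \<Longrightarrow> v \<in> X"
    and conn: "\<And>u v. u \<in> X \<Longrightarrow> v \<in> X \<Longrightarrow> (u, v) \<in> (parcs H)\<^sup>*"
  shows "connected_graph (restrict_graph H X)"
proof (rule connected_graph.intro)
  show "pair_graph (restrict_graph H X)"
    using component_union_restrict_graph[OF H X(1) closed] by (simp add: component_union_def)
  have reach: "v \<in> X \<and> (u, v) \<in> (parcs H \<inter> X \<times> X)\<^sup>*" if "(u, v) \<in> (parcs H)\<^sup>*" "u \<in> X" for u v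
    using that by induction (auto intro: closed rtrancl_into_rtrancl)
  fix u v assume "u \<in> pverts (restrict_graph H X)" "v \<in> pverts (restrict_graph H X)"
  then have "u \<in> X" "v \<in> X" by simp_all
  with reach[OF conn] show "(u, v) \<in> (parcs (restrict_graph H X))\<^sup>*"
    unfolding restrict_graph_simps by blast
qed (use X in simp)

context two_main_factors
begin

lemma tree_or_disjoint_union:
  assumes ne: "pverts H \<noteq> {}" and arcs: "card (parcs H) = 2 * (card (pverts H) - 1)"
    and odd: "\<And>u k. odd k \<Longrightarrow> (u, u) \<notin> parcs H ^^ k"
  shows "tree_graph H \<or>
    (\<exists>R U. is_disjoint_union H R U \<and> tree_graph R \<and> unicyclic_graph U \<and> bipartite_graph U)"
proof (cases "\<forall>u\<in>pverts H. \<forall>v\<in>pverts H. (u, v) \<in> (parcs H)\<^sup>*")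
  case True
  then interpret connected_graph H using H ne by (intro connected_graph.intro) auto
  have "card (pverts H) \<noteq> 0" using ne pair_graph_finite[OF H] by simp
  then have "ugraph_cycles H = {}" using card_parcs_ge_if_cycle arcs by fastforce
  then show ?thesis by (simp add: tree_graph_iff)
next
  case False
  then obtain r s where rs: "r \<in> pverts H" "s \<in> pverts H" "(r, s) \<notin> (parcs H)\<^sup>*" by blast
  let ?E = "(parcs H)\<^sup>*"
  have sym: "(v, u) \<in> ?E" if "(u, v) \<in> ?E" for u v
    using that sym_rtrancl[OF sym_parcs[OF H]] by (blast dest: symD)
  have reach_verts: "v \<in> pverts H" if "(u, v) \<in> ?E" "u \<in> pverts H" for u v
    using that by induction (auto dest: pair_graph_arcD[OF H])
  define X where "X = {v. (r, v) \<in> ?E}"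
  define Y where "Y = pverts H - X"
  have X: "X \<subseteq> pverts H" "r \<in> X" using rs(1) reach_verts by (auto simp: X_def)
  have Y: "Y \<subseteq> pverts H" "s \<in> Y" using rs by (auto simp: X_def Y_def)
  have X_closed: "v \<in> X" if "u \<in> X" "(u, v) \<in> parcs H" for u v
    using that by (auto simp: X_def intro: rtrancl_into_rtrancl)
  have Y_closed: "v \<in> Y" if "u \<in> Y" "(u, v) \<in> parcs H" for u v
    using that X_closed pair_graph_sym[OF H] pair_graph_arcD[OF H] by (auto simp: Y_def)
  have X_conn: "(u, v) \<in> ?E" if "u \<in> X" "v \<in> X" for u v
    using that sym by (auto simp: X_def intro: rtrancl_trans)
  \<comment> \<open>If \<open>Y\<close> were disconnected, the component of \<open>u\<close> and the
    rest of \<open>Y\<close> would be a second and a third piece beside \<open>X\<close>.\<close>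
  have Y_conn: "(u, v) \<in> ?E" if uv: "u \<in> Y" "v \<in> Y" for u v
  proof (rule ccontr)
    assume not: "(u, v) \<notin> ?E"
    define Z where "Z = {w. (u, w) \<in> ?E}"
    have Z: "Z \<subseteq> Y"
    proof
      fix w assume "w \<in> Z"
      then have "(u, w) \<in> ?E" by (simp add: Z_def)
      then show "w \<in> Y" by induction (use uv Y_closed in auto)
    qed
    have Z_closed: "w' \<in> Z" if "w \<in> Z" "(w, w') \<in> parcs H" for w w'
      using that by (auto simp: Z_def intro: rtrancl_into_rtrancl)
    have W_closed: "w' \<in> Y - Z" if "w \<in> Y - Z" "(w, w') \<in> parcs H" for w w'
      using that Y_closed Z_closed pair_graph_sym[OF H] by blast
    have "Z \<subseteq> pverts H" "Y - Z \<subseteq> pverts H" using Z Y by auto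
    then have "component_union (restrict_graph H Z) H" "component_union (restrict_graph H (Y - Z)) H"
      using Z_closed W_closed by (intro component_union_restrict_graph[OF H]; blast)+
    moreover have "component_union (restrict_graph H X) H"
      using X_closed by (intro component_union_restrict_graph[OF H X(1)])
    moreover have "r \<in> X" "u \<in> Z" "v \<in> Y - Z" "X \<inter> Z = {}" "X \<inter> (Y - Z) = {}"
      using X(2) Z uv not by (auto simp: Y_def Z_def)
    ultimately show False
      using no_three_components[of "restrict_graph H X" "restrict_graph H Z" "restrict_graph H (Y - Z)"]
      by auto
  qed
  let ?R = "restrict_graph H X" and ?U = "restrict_graph H Y"
  have R: "connected_graph ?R"
  proof (rule connected_graph_restrict_graph[OF H X(1)])
    show "X \<noteq> {}" using X(2) by blast
  qed (erule X_closed X_conn, assumption)+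
  have U: "connected_graph ?U"
  proof (rule connected_graph_restrict_graph[OF H Y(1)])
    show "Y \<noteq> {}" using Y(2) by blast
  qed (erule Y_closed Y_conn, assumption)+
  interpret R: connected_graph ?R by (rule R)
  interpret U: connected_graph ?U by (rule U)
  have "u \<in> X \<and> v \<in> X \<or> u \<in> Y \<and> v \<in> Y" if "(u, v) \<in> parcs H" for u v
    using that X_closed[of u v] Y_closed[of u v] pair_graph_arcD(1)[OF H that] by (auto simp: Y_def)
  then have parcs: "parcs H = parcs ?R \<union> parcs ?U" "parcs ?R \<inter> parcs ?U = {}"
    by (auto simp: Y_def)
  have verts: "pverts H = X \<union> Y" "X \<inter> Y = {}"
    using X(1) by (auto simp: Y_def)
  have "is_disjoint_union H ?R ?U"
    unfolding is_disjoint_union_def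
  proof
    show "H = \<lparr>pverts = pverts ?R \<union> pverts ?U, parcs = parcs ?R \<union> parcs ?U\<rparr>"
      using verts(1) parcs(1) by (intro pair_pre_digraph.equality) simp_all
  qed (simp add: verts(2))
  moreover from this have "is_disjoint_union H ?U ?R"
    unfolding is_disjoint_union_def by (metis Int_commute Un_commute)
  ultimately have union: "is_disjoint_union H ?R ?U" "is_disjoint_union H ?U ?R" .
  have "finite X" "finite Y" using X Y pair_graph_finite[OF H] by (auto intro: finite_subset)
  then have nz: "card X \<noteq> 0" "card Y \<noteq> 0" using X Y by auto
  have "card (pverts H) = card X + card Y"
    unfolding verts(1) using \<open>finite X\<close> \<open>finite Y\<close> verts(2) by (rule card_Un_disjoint)
  moreover have "card (parcs H) = card (parcs ?R) + card (parcs ?U)"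
    unfolding parcs(1) using R.finite_parcs U.finite_parcs parcs(2) by (rule card_Un_disjoint)
  ultimately have card: "card (parcs ?R) + card (parcs ?U) = 2 * (card X + card Y - 1)"
    using arcs by simp
  have odd': "(u, u) \<notin> parcs (restrict_graph H Z) ^^ k" if "odd k" for Z u k
  proof -
    have "(u, v) \<in> parcs H ^^ j" if "(u, v) \<in> parcs (restrict_graph H Z) ^^ j" for v j
      using that by (induction j arbitrary: v) auto
    with odd[OF that] show ?thesis by blast
  qed
  note bip = R.bipartite_graph_if_no_odd_closed_walk[OF odd']
    U.bipartite_graph_if_no_odd_closed_walk[OF odd']
  show ?thesis
  \<comment> \<open>Together the pieces have two arcs, that is one edge, more than two trees on the
    same vertex sets. If one piece is a tree, the other one has this surplus edge.\<close>
  proof (cases "ugraph_cycles ?R = {}")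
    case True
    then have "card (parcs ?U) = 2 * card (pverts ?U)"
      using R.acyclic_card_parcs_coloring(1) card nz by simp
    then have "unicyclic_graph ?U" by (rule U.unicyclic_graph_if_card_parcs)
    then show ?thesis using union(1) bip(2) True R.tree_graph_iff by blast
  next
    case False
    \<comment> \<open>A cycle in \<open>?R\<close> uses up the whole surplus, so \<open>?U\<close>
      is the tree and the roles are exchanged.\<close>
    then have "2 * card X \<le> card (parcs ?R)" using R.card_parcs_ge_if_cycle by auto
    moreover have "2 * (card Y - 1) \<le> card (parcs ?U)" using U.card_parcs_ge by simp
    ultimately have *: "card (parcs ?R) = 2 * card (pverts ?R)" "card (parcs ?U) < 2 * card (pverts ?U)"
      using card nz by simp_all
    have "unicyclic_graph ?R" using *(1) by (rule R.unicyclic_graph_if_card_parcs)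
    moreover have "ugraph_cycles ?U = {}" using *(2) U.card_parcs_ge_if_cycle by fastforce
    ultimately show ?thesis using union(2) bip(1) U.tree_graph_iff by blast
  qed
qed

end

theorem theorem4p1:
  fixes T :: "'a pair_pre_digraph"
  assumes "tree_graph T"
    and "main_factor_mult T = 2"
  shows "\<exists>f g :: int poly.
    f \<noteq> g \<and> monic f \<and> monic g \<and>
    irreducible (map_poly rat_of_int f) \<and> irreducible (map_poly rat_of_int g) \<and>
    main_poly T = map_poly real_of_int f * map_poly real_of_int g \<and>
    multiplicity (map_poly rat_of_int f) (graph_poly T) = 1 \<and>
    multiplicity (map_poly rat_of_int g) (graph_poly T) = 1 \<and>
    (\<forall>H :: 'b pair_pre_digraph. pair_graph H \<and> generalized_cospectral H T \<longrightarrow>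
       (tree_graph H \<or>
        (\<exists>R U. is_disjoint_union H R U \<and> tree_graph R \<and> unicyclic_graph U \<and> bipartite_graph U)) \<and>
       (\<forall>R U. is_disjoint_union H R U \<and> tree_graph R \<and> unicyclic_graph U \<and> bipartite_graph U \<longrightarrow>
          (main_poly R = map_poly real_of_int f \<and> main_poly U = map_poly real_of_int g) \<or>
          (main_poly R = map_poly real_of_int g \<and> main_poly U = map_poly real_of_int f)))"
proof -
  interpret T: connected_graph T using tree_graph_imp_connected[OF assms(1)] .
  have acyclic: "ugraph_cycles T = {}" using assms(1) by (simp add: tree_graph_def)
  obtain f' g' :: "rat poly" where fg': "f' \<noteq> g'" "monic f'" "monic g'" "irreducible f'" "irreducible g'"
    and main: "main_rat T = f' * g'"
    and mult: "multiplicity f' (graph_poly T) = 1" "multiplicity g' (graph_poly T) = 1"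
    using main_factors[OF T.connected_graph_axioms assms(2)] .
  have dvd: "f' dvd graph_poly T" "g' dvd graph_poly T"
    using main_rat_dvd[of T] unfolding main by (auto dest: dvd_mult_left dvd_mult_right)
  \<comment> \<open>The characteristic polynomial is monic and integral, so its monic rational
    factors are integral by Gauss's lemma.\<close>
  have phi: "graph_poly T = map_poly rat_of_int (char_poly (adj_matrix T))"
    by (simp only: of_int_hom.map_graph_char_poly)
  obtain f where f: "monic f" "map_poly rat_of_int f = f'"
    using monic_rat_factor_of_int_poly[OF monic_graph_char_poly fg'(2) dvd(1)[unfolded phi]] .
  obtain g where g: "monic g" "map_poly rat_of_int g = g'"
    using monic_rat_factor_of_int_poly[OF monic_graph_char_poly fg'(3) dvd(2)[unfolded phi]] .
  have real: "map_poly real_of_int p = map_poly real_of_rat (map_poly rat_of_int p)" for p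
    by (simp add: map_poly_map_poly o_def)
  have main_poly: "main_poly T = map_poly real_of_rat (f' * g')"
    using map_main_rat[OF T.G] by (simp add: main)
  have H: "(tree_graph H \<or>
        (\<exists>R U. is_disjoint_union H R U \<and> tree_graph R \<and> unicyclic_graph U \<and> bipartite_graph U)) \<and>
       (\<forall>R U. is_disjoint_union H R U \<and> tree_graph R \<and> unicyclic_graph U \<and> bipartite_graph U \<longrightarrow>
          (main_poly R = map_poly real_of_rat f' \<and> main_poly U = map_poly real_of_rat g') \<or>
          (main_poly R = map_poly real_of_rat g' \<and> main_poly U = map_poly real_of_rat f'))"
    if H: "pair_graph H" and cosp: "generalized_cospectral H T" for H :: "'b pair_pre_digraph"
  proof -
    note D = generalized_cospectralD[OF H T.G cosp]
    interpret two_main_factors H f' g'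
      using H fg' main_poly mult by (intro two_main_factors.intro) (simp_all add: D)
    have spec: "adj_spectrum T = adj_spectrum H" using cosp by (simp add: generalized_cospectral_def)
    have "pverts H \<noteq> {}" using D(2) T.ne pair_graph_finite[OF T.G] by auto
    moreover have "card (parcs H) = 2 * (card (pverts H) - 1)"
      using card_parcs_cong[OF T.G H spec] T.acyclic_card_parcs_coloring(1)[OF acyclic] D(2) by simp
    \<comment> \<open>A two-colouring of \<open>T\<close> excludes odd closed walks in
      \<open>T\<close>, and the common spectrum passes this on to \<open>H\<close>.\<close>
    moreover obtain d :: "'a \<Rightarrow> nat" where d: "\<And>u v. (u, v) \<in> parcs T \<Longrightarrow> even (d u) \<noteq> even (d v)"
      using T.acyclic_card_parcs_coloring(2)[OF acyclic] by blast
    have "(u, u) \<notin> parcs H ^^ k" if "odd k" for u k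
      using no_odd_closed_walk_cong[OF T.G H spec coloring_imp_no_odd_closed_walk[OF d that] that] .
    ultimately have "tree_graph H \<or>
        (\<exists>R U. is_disjoint_union H R U \<and> tree_graph R \<and> unicyclic_graph U \<and> bipartite_graph U)"
      by (rule tree_or_disjoint_union)
    \<comment> \<open>This is shown for every decomposition of \<open>H\<close>, not only for the
      one constructed above.\<close>
    moreover have "(main_poly R = map_poly real_of_rat f' \<and> main_poly U = map_poly real_of_rat g') \<or>
          (main_poly R = map_poly real_of_rat g' \<and> main_poly U = map_poly real_of_rat f')"
      if union: "is_disjoint_union H R U" and "tree_graph R" "unicyclic_graph U" for R U
    proof -
      interpret R: connected_graph R using tree_graph_imp_connected[OF that(2)] .
      interpret U: connected_graph U using unicyclic_graph_imp_connected[OF that(3)] .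
      show ?thesis
        using is_disjoint_union_component_union[OF union R.G U.G] R.ne U.ne union
        by (intro main_poly_disjoint_union) (auto simp: is_disjoint_union_def)
    qed
    ultimately show ?thesis by blast
  qed
  show ?thesis
    using f g fg' mult main_poly H
    by (intro exI[of _ f] exI[of _ g]) (auto simp: real hom_distribs)
qed

end
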